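(* For every integer $t\ge1$ there exist a positive integer $n_0$ and a constant $\alpha>0$ (both depending only on $t$) such that for every odd integer $n>n_0$ there exists a $20t$-regular graph $G$ with $n$ nodes and $10nt$ edges such that the Tseitin polytope $P_{TS(G)}$ has $t$-dimensional lattice rank at least $\alpha n$.
   Context: Tseitin polytope: let $G=(V,E)$ be a finite undirected graph and for $u\in V$ let $N(u)=\{v\in V: uv\in E\}$. The Tseitin polytope $P_{TS(G)}\subseteq[0,1]^{|E|}$ (variables $x_{uv}$ indexed by the edges $uv\in E$) is described by the inequalities $\sum_{v\in N(u)\setminus F} x_{uv}+\sum_{v\in F}(1-x_{uv})\ge 1$ for all $u\in V$ and all $F\subseteq N(u)$ with $|F|$ even, together with $0\le x_{uv}\le 1$ for all $uv\in E$. Lattice closure and rank: for $P\subseteq\mathbb{R}^m$, the $t$-dimensional lattice closure of $P$ is $$tLC(P)=\bigcap_{\pi^1,\dots,\pi^t\in\mathbb{Z}^m}\mathrm{conv}\Big(\bigcap_{j=1}^t\{x\in P:\pi^j x\in\mathbb{Z}\}\Big),$$ where $\pi x$ denotes the inner product of $\pi$ and $x$. Put $tLC^0(P)=P$ and $tLC^k(P)=tLC(tLC^{k-1}(P))$ for $k\ge1$. Let $P_I$ denote the convex hull of the integral points of $P$. The $t$-dimensional lattice rank of $P$ is the minimum $k\ge0$ such that $tLC^k(P)=P_I$. *)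

theory Defs
  imports "HOL-Analysis.Analysis" "HOL-Analysis.Finite_Function_Topology"
begin

text \<open>
  The edge set of the graph is bound inside the main statement, so the dimension of the ambient
  space cannot be a type. A vector of \<open>\<real>\<^sup>E\<close>, for a finite set \<open>E\<close>, is a finitely supported function
  that vanishes outside \<open>E\<close>. These functions form a real vector space, so the library's
  \<open>convex hull\<close> applies, and the hull of a subset of \<open>\<real>\<^sup>E\<close> stays in \<open>\<real>\<^sup>E\<close>.
\<close>

definition coord_space :: "'e set \<Rightarrow> ('e \<Rightarrow>\<^sub>0 real) set" where
  "coord_space E = {x. Poly_Mapping.keys x \<subseteq> E}"

text \<open>Only the values of \<open>\<pi>\<close> on \<open>E\<close> matter, so \<open>\<pi>\<close> ranges over \<open>\<int>\<^sup>E\<close> when it ranges over all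
  integer-valued functions.\<close>

definition int_inner :: "'e set \<Rightarrow> ('e \<Rightarrow> int) \<Rightarrow> ('e \<Rightarrow>\<^sub>0 real) \<Rightarrow> real" where
  "int_inner E \<pi> x = (\<Sum>e\<in>E. of_int (\<pi> e) * Poly_Mapping.lookup x e)"

definition lattice_closure ::
    "'e set \<Rightarrow> nat \<Rightarrow> ('e \<Rightarrow>\<^sub>0 real) set \<Rightarrow> ('e \<Rightarrow>\<^sub>0 real) set" where
  "lattice_closure E t P =
     (\<Inter>\<pi> :: nat \<Rightarrow> 'e \<Rightarrow> int. convex hull (\<Inter>j\<in>{1..t}. {x \<in> P. int_inner E (\<pi> j) x \<in> \<int>}))"

definition integer_hull :: "'e set \<Rightarrow> ('e \<Rightarrow>\<^sub>0 real) set \<Rightarrow> ('e \<Rightarrow>\<^sub>0 real) set" where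
  "integer_hull E P = convex hull {x \<in> P. \<forall>e\<in>E. Poly_Mapping.lookup x e \<in> \<int>}"

text \<open>
  The minimum is taken in the extended naturals, so that it would be \<open>\<infinity>\<close> if no iterate were
  the integer hull. For \<open>t \<ge> 1\<close> and \<open>P\<close> contained in the unit cube of \<open>\<real>\<^sup>E\<close> this does not happen:
  taking the coordinate vectors for \<open>\<pi>\<close> one at a time, the integer hull is reached after at most
  \<open>card E\<close> steps.
\<close>

definition lattice_rank :: "'e set \<Rightarrow> nat \<Rightarrow> ('e \<Rightarrow>\<^sub>0 real) set \<Rightarrow> enat" where
  "lattice_rank E t P =
     Inf (enat ` {k. (lattice_closure E t ^^ k) P = integer_hull E P})"

definition simple_graph :: "'v set \<Rightarrow> 'v set set \<Rightarrow> bool" where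
  "simple_graph V E \<longleftrightarrow> finite V \<and> (\<forall>e\<in>E. e \<subseteq> V \<and> card e = 2)"

definition nbrs :: "'v set \<Rightarrow> 'v set set \<Rightarrow> 'v \<Rightarrow> 'v set" where
  "nbrs V E u = {v \<in> V. {u, v} \<in> E}"

definition regular_graph :: "'v set \<Rightarrow> 'v set set \<Rightarrow> nat \<Rightarrow> bool" where
  "regular_graph V E d \<longleftrightarrow> (\<forall>u\<in>V. card (nbrs V E u) = d)"

definition tseitin_polytope :: "'v set \<Rightarrow> 'v set set \<Rightarrow> ('v set \<Rightarrow>\<^sub>0 real) set" where
  "tseitin_polytope V E =
     {x \<in> coord_space E.
        (\<forall>u\<in>V. \<forall>F. F \<subseteq> nbrs V E u \<and> even (card F) \<longrightarrow>
           (\<Sum>v\<in>nbrs V E u - F. Poly_Mapping.lookup x {u, v})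
             + (\<Sum>v\<in>F. 1 - Poly_Mapping.lookup x {u, v}) \<ge> 1) \<and>
        (\<forall>e\<in>E. 0 \<le> Poly_Mapping.lookup x e \<and> Poly_Mapping.lookup x e \<le> 1)}"

end

theory Submission
  imports Defs
begin

text \<open>
  Since \<open>n\<close> is odd and every integral point of the Tseitin polytope assigns an odd number of ones to
  the edges at each vertex, the integer hull is empty; so it suffices to keep some point alive
  through linearly many lattice closures. The point with all coordinates \<open>1/2\<close> survives if the graph
  is locally sparse: every set \<open>W\<close> of at most \<open>M\<close> vertices, \<open>M\<close> linear in \<open>n\<close>, spans at most
  \<open>c * card W\<close> edges. This is played as a game on half-integral points.

  Let \<open>x\<close> be half-integral with set \<open>H\<close> of edges of value \<open>1/2\<close>, and let \<open>t\<close> integer vectors be given.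
  Rounding a set \<open>S\<close> of edges of \<open>H\<close> makes all \<open>t\<close> inner products integral iff the sum of each vector
  over \<open>H - S\<close> is even, whichever way the edges of \<open>S\<close> are rounded. By linear algebra over the field
  with two elements some \<open>S\<close> with at most \<open>t\<close> edges does this (\<open>even_sum_of_few\<close>), and \<open>x\<close> is the average
  of all roundings of \<open>S\<close>. The rounded points stay in the polytope as long as every vertex has two
  edges of value \<open>1/2\<close>, or has none and an odd number of ones. To maintain this, vertices with too few
  edges of value \<open>1/2\<close> are settled before each round: all their remaining edges are rounded subject to
  the parity conditions (\<open>half_pt_settle_vertices\<close>). That can be done without moving the average,
  because by sparsity every set of vertices to be settled contains a vertex with two edges leaving
  the set, so that the vertices can be settled one by one, each with two edges to choose
  (\<open>many_leaving_edges\<close>). Sparsity also bounds the number of settled vertices: each of them has lost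
  most of its \<open>d\<close> edges; the lost edges either join two settled vertices, which by sparsity holds for
  at most \<open>c\<close> edges per settled vertex, or are among the at most \<open>t\<close> edges chosen in each round (\<open>extend_charged\<close>, \<open>charged_small\<close>). Hence
  about \<open>M / t\<close> rounds can be played (\<open>position_step\<close>, \<open>lattice_rank_ge\<close>).

  A locally sparse graph exists by counting. Take a random \<open>m\<close>-fold lift of the complete graph on
  \<open>20 * t + 1\<close> vertices: it is simple and \<open>20 * t\<close>-regular whatever the permutations are, and a union
  bound over the sets \<open>W\<close> and over the sets of \<open>2 * card W\<close> edges inside \<open>W\<close> shows that for some choice
  of permutations every small \<open>W\<close> spans at most \<open>2 * card W\<close> edges (\<open>exists_sparse_lift\<close>). The number
  of vertices is corrected to \<open>n\<close> by removing a matching and joining its end points to the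
  \<open>n mod (20 * t + 1)\<close> new vertices. Every old vertex gets at most one new edge, so \<open>c = 3\<close>
  (\<open>insert_vertices\<close>).
\<close>

section \<open>Half-integral points as averages of their roundings\<close>

lemma lookup_scaleR_pm:
  fixes x :: "'e \<Rightarrow>\<^sub>0 'b::real_vector"
  shows "Poly_Mapping.lookup (c *\<^sub>R x) e = c *\<^sub>R Poly_Mapping.lookup x e"
proof -
  have "finite {i. c *\<^sub>R Poly_Mapping.lookup x i \<noteq> 0}"
    by (rule finite_subset[OF _ finite_keys[of x]]) (auto simp: in_keys_iff)
  then show ?thesis
    by (simp add: scaleR_poly_mapping_def Abs_poly_mapping_inverse)
qed

definition half_pt :: "'e set \<Rightarrow> 'e set \<Rightarrow> ('e \<Rightarrow>\<^sub>0 real)" where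
  "half_pt H A = Abs_poly_mapping (\<lambda>e. if e \<in> H then 1/2 else if e \<in> A then 1 else 0)"

lemma lookup_half_pt:
  assumes "finite H" "finite A"
  shows "Poly_Mapping.lookup (half_pt H A) e = (if e \<in> H then 1/2 else if e \<in> A then 1 else 0)"
proof -
  have "finite {e. (if e \<in> H then 1/2 else if e \<in> A then 1 else 0) \<noteq> (0::real)}"
    by (rule finite_subset[of _ "H \<union> A"]) (use assms in \<open>auto split: if_splits\<close>)
  then show ?thesis
    by (simp add: half_pt_def Abs_poly_mapping_inverse)
qed

lemma in_convex_hull_trans:
  "x \<in> convex hull S \<Longrightarrow> S \<subseteq> convex hull T \<Longrightarrow> x \<in> convex hull T"
  by (meson convex_convex_hull hull_minimal subsetD)

lemma midpoint_in_hull: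
  assumes "a \<in> convex hull S" "b \<in> convex hull S" "x = (1/2) *\<^sub>R a + (1/2) *\<^sub>R b"
  shows "x \<in> convex hull S"
  using convexD[OF convex_convex_hull assms(1,2), of "1/2" "1/2"] assms(3) by simp

lemma half_pt_fix_edge:
  assumes "finite H" "finite A" "e \<notin> H" "e \<notin> A"
  shows "half_pt (insert e H) A = (1/2) *\<^sub>R half_pt H A + (1/2) *\<^sub>R half_pt H (insert e A)"
  using assms by (intro poly_mapping_eqI) (auto simp: lookup_add lookup_scaleR_pm lookup_half_pt)

lemma half_pt_fix_pair_equal:
  assumes "finite H" "finite A" "e \<notin> H" "e \<notin> A" "f \<notin> H" "f \<notin> A"
  shows "half_pt (insert e (insert f H)) A =
    (1/2) *\<^sub>R half_pt H A + (1/2) *\<^sub>R half_pt H (insert e (insert f A))"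
  using assms by (intro poly_mapping_eqI) (auto simp: lookup_add lookup_scaleR_pm lookup_half_pt)

lemma half_pt_fix_pair_opposite:
  assumes "finite H" "finite A" "e \<notin> H" "e \<notin> A" "f \<notin> H" "f \<notin> A" "e \<noteq> f"
  shows "half_pt (insert e (insert f H)) A =
    (1/2) *\<^sub>R half_pt H (insert e A) + (1/2) *\<^sub>R half_pt H (insert f A)"
  using assms by (intro poly_mapping_eqI) (auto simp: lookup_add lookup_scaleR_pm lookup_half_pt)

lemma half_pt_fix_set:
  assumes "finite S" "finite H" "finite A" "S \<inter> H = {}" "S \<inter> A = {}"
  shows "half_pt (H \<union> S) A \<in> convex hull {half_pt H (A \<union> T) | T. T \<subseteq> S}"
  using assms
proof (induction S arbitrary: H A rule: finite_induct)
  case empty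
  then show ?case by (auto intro!: hull_inc)
next
  case (insert e S)
  have step: "half_pt (insert e (H \<union> S)) A =
      (1/2) *\<^sub>R half_pt (H \<union> S) A + (1/2) *\<^sub>R half_pt (H \<union> S) (insert e A)"
    using insert by (intro half_pt_fix_edge) auto
  have "half_pt (H \<union> S) A \<in> convex hull {half_pt H (A \<union> T) | T. T \<subseteq> S}"
    using insert by (intro insert.IH) auto
  then have 1: "half_pt (H \<union> S) A \<in> convex hull {half_pt H (A \<union> T) | T. T \<subseteq> insert e S}"
    by (rule subsetD[OF hull_mono, rotated]) auto
  have "half_pt (H \<union> S) (insert e A) \<in> convex hull {half_pt H (insert e A \<union> T) | T. T \<subseteq> S}"
    using insert by (intro insert.IH) auto
  moreover have "{half_pt H (insert e A \<union> T) | T. T \<subseteq> S} \<subseteq> {half_pt H (A \<union> T) | T. T \<subseteq> insert e S}"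
  proof clarify
    fix T assume "T \<subseteq> S"
    then show "\<exists>T'. half_pt H (insert e A \<union> T) = half_pt H (A \<union> T') \<and> T' \<subseteq> insert e S"
      by (intro exI[of _ "insert e T"]) auto
  qed
  ultimately have 2: "half_pt (H \<union> S) (insert e A) \<in> convex hull {half_pt H (A \<union> T) | T. T \<subseteq> insert e S}"
    using hull_mono by blast
  show ?case
    using midpoint_in_hull[OF 1 2 step] by simp
qed

text \<open>The parity of the rounding can be prescribed because two edges are left to the end: rounding
  them either equally or oppositely fixes the parity and still averages to \<open>1/2\<close> on both. A single
  edge would be forced, and the average would move.\<close>

lemma half_pt_fix_set_parity:
  assumes "finite S" "finite H" "finite A" "S \<inter> H = {}" "S \<inter> A = {}" "2 \<le> card S"
  shows "half_pt (H \<union> S) A \<in> convex hull {half_pt H (A \<union> T) | T. T \<subseteq> S \<and> odd (card T) = b}"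
    (is "_ \<in> convex hull ?Y")
proof -
  obtain e where e: "e \<in> S" using assms(6) by fastforce
  have "card (S - {e}) \<ge> 1" using assms e by simp
  then obtain f where f: "f \<in> S" "f \<noteq> e"
    by (metis Diff_iff One_nat_def card.empty ex_in_conv insertI1 not_less_eq_eq le0)
  define R where "R = S - {e, f}"
  have S: "S = insert e (insert f R)" "e \<notin> R" "f \<notin> R" "finite R"
    using e f assms(1) by (auto simp: R_def)
  have "half_pt ((insert e (insert f H)) \<union> R) A \<in>
      convex hull {half_pt (insert e (insert f H)) (A \<union> T) | T. T \<subseteq> R}"
    using assms S by (intro half_pt_fix_set) auto
  moreover have "{half_pt (insert e (insert f H)) (A \<union> T) | T. T \<subseteq> R} \<subseteq> convex hull ?Y"
  proof clarify
    fix T assume T: "T \<subseteq> R"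
    then have fT: "finite T" using S(4) finite_subset by blast
    have nin: "e \<notin> T" "f \<notin> T" "T \<subseteq> S" "e \<notin> H" "e \<notin> A \<union> T" "f \<notin> H" "f \<notin> A \<union> T"
      using T S assms(4,5) by auto
    have fin: "finite (A \<union> T)" using fT assms by auto
    show "half_pt (insert e (insert f H)) (A \<union> T) \<in> convex hull ?Y"
    proof (cases "odd (card T) = b")
      case True
      have "half_pt H (A \<union> T) \<in> ?Y" using True nin by blast
      moreover have "half_pt H (insert e (insert f (A \<union> T))) \<in> ?Y"
        using True nin e f fT by (intro CollectI exI[of _ "insert e (insert f T)"]) simp
      ultimately show ?thesis
        by (intro midpoint_in_hull[OF _ _ half_pt_fix_pair_equal[OF assms(2) fin nin(4-7)]] hull_inc)
    next
      case False
      have "half_pt H (insert e (A \<union> T)) \<in> ?Y"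
        using False nin e fT by (intro CollectI exI[of _ "insert e T"]) auto
      moreover have "half_pt H (insert f (A \<union> T)) \<in> ?Y"
        using False nin f fT by (intro CollectI exI[of _ "insert f T"]) auto
      ultimately show ?thesis
        by (intro midpoint_in_hull[OF _ _ half_pt_fix_pair_opposite[OF assms(2) fin nin(4-7)
              f(2)[symmetric]]] hull_inc)
    qed
  qed
  moreover have "H \<union> S = insert e (insert f H) \<union> R" using S by auto
  ultimately show ?thesis by (simp only: in_convex_hull_trans)
qed

text \<open>All edges meeting \<open>N\<close> are rounded so that every vertex of \<open>N\<close> sees an odd number of ones. The
  last vertex to be settled is one with two edges leaving \<open>N\<close>: settling the others does not touch
  those edges, so they can still absorb its parity. The hypothesis passes to subsets of \<open>N\<close>, and
  the order of settling comes from induction.\<close>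

lemma half_pt_settle_vertices:
  assumes "finite N" "finite H" "finite A" "H \<inter> A = {}"
    and "\<And>W. W \<subseteq> N \<Longrightarrow> W \<noteq> {} \<Longrightarrow> \<exists>u\<in>W. 2 \<le> card {e\<in>H. e \<inter> W = {u}}"
  shows "half_pt H A \<in> convex hull
    {half_pt {e\<in>H. e \<inter> N = {}} (A \<union> T) | T. T \<subseteq> {e\<in>H. e \<inter> N \<noteq> {}} \<and>
        (\<forall>u\<in>N. odd (card {e \<in> A \<union> T. u \<in> e}))}"
  using assms
proof (induction "card N" arbitrary: N)
  case 0
  then show ?case by (auto intro!: hull_inc)
next
  case (Suc k)
  have "N \<noteq> {}" using Suc.hyps(2) by auto
  then obtain u where u: "u \<in> N" "2 \<le> card {e\<in>H. e \<inter> N = {u}}"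
    using Suc.prems(5)[OF order.refl] by blast
  define N' where "N' = N - {u}"
  let ?Y' = "{half_pt {e\<in>H. e \<inter> N' = {}} (A \<union> T) | T. T \<subseteq> {e\<in>H. e \<inter> N' \<noteq> {}} \<and>
        (\<forall>u\<in>N'. odd (card {e \<in> A \<union> T. u \<in> e}))}"
  let ?Y = "{half_pt {e\<in>H. e \<inter> N = {}} (A \<union> T) | T. T \<subseteq> {e\<in>H. e \<inter> N \<noteq> {}} \<and>
        (\<forall>u\<in>N. odd (card {e \<in> A \<union> T. u \<in> e}))}"
  have "half_pt H A \<in> convex hull ?Y'"
  proof (rule Suc.hyps(1))
    show "k = card N'" using Suc.hyps(2) Suc.prems(1) u by (simp add: N'_def)
    show "\<And>W. W \<subseteq> N' \<Longrightarrow> W \<noteq> {} \<Longrightarrow> \<exists>u\<in>W. 2 \<le> card {e \<in> H. e \<inter> W = {u}}"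
      using Suc.prems(5) by (simp add: N'_def) blast
  qed (use Suc.prems in \<open>auto simp: N'_def\<close>)
  moreover have "?Y' \<subseteq> convex hull ?Y"
  proof clarify
    fix T assume T: "T \<subseteq> {e\<in>H. e \<inter> N' \<noteq> {}}" and par: "\<forall>u\<in>N'. odd (card {e \<in> A \<union> T. u \<in> e})"
    \<comment> \<open>The edges that are left for \<open>u\<close>, and the parity that they have to supply.\<close>
    define S where "S = {e\<in>H. e \<inter> N = {u}}"
    define H' where "H' = {e\<in>H. e \<inter> N = {}}"
    define b where "b = even (card {e \<in> A \<union> T. u \<in> e})"
    have fT: "finite T" using T Suc.prems(2) finite_subset by fastforce
    have HS: "{e\<in>H. e \<inter> N' = {}} = H' \<union> S"
      using u(1) by (auto simp: H'_def S_def N'_def)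
    have fS: "finite S" using Suc.prems(2) by (simp add: S_def)
    have "half_pt (H' \<union> S) (A \<union> T) \<in>
        convex hull {half_pt H' ((A \<union> T) \<union> Q) | Q. Q \<subseteq> S \<and> odd (card Q) = b}"
      by (rule half_pt_fix_set_parity)
        (use Suc.prems fT T u fS in \<open>auto simp: H'_def S_def N'_def\<close>)
    moreover have "{half_pt H' ((A \<union> T) \<union> Q) | Q. Q \<subseteq> S \<and> odd (card Q) = b} \<subseteq> ?Y"
    proof clarify
      fix Q assume Q: "Q \<subseteq> S" "b = odd (card Q)"
      have fQ: "finite Q" using Q fS finite_subset by blast
      have sub: "T \<union> Q \<subseteq> {e\<in>H. e \<inter> N \<noteq> {}}"
        using T Q by (auto simp: S_def N'_def)
      have "odd (card {e \<in> A \<union> (T \<union> Q). w \<in> e})" if w: "w \<in> N" for w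
      proof (cases "w = u")
        case True
        have "{e \<in> A \<union> (T \<union> Q). u \<in> e} = {e \<in> A \<union> T. u \<in> e} \<union> Q"
          using Q by (auto simp: S_def)
        moreover have "{e \<in> A \<union> T. u \<in> e} \<inter> Q = {}"
        proof (rule ccontr)
          assume "{e \<in> A \<union> T. u \<in> e} \<inter> Q \<noteq> {}"
          then obtain e where e: "e \<in> Q" "e \<in> A \<or> e \<in> T" by blast
          then have "e \<in> H" "e \<inter> N = {u}" using Q(1) by (auto simp: S_def)
          then have "e \<inter> N' = {}" "e \<notin> A" using Suc.prems(4) by (auto simp: N'_def)
          then show False using e(2) T by auto
        qed
        ultimately have "card {e \<in> A \<union> (T \<union> Q). u \<in> e} = card {e \<in> A \<union> T. u \<in> e} + card Q"
          using fQ fT Suc.prems(3) by (simp add: card_Un_disjoint)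
        then show ?thesis using True Q(2) by (auto simp: b_def)
      next
        case False
        then have wN: "w \<in> N'" using w by (simp add: N'_def)
        have "{e \<in> A \<union> (T \<union> Q). w \<in> e} = {e \<in> A \<union> T. w \<in> e}"
          using Q False w by (auto simp: S_def)
        then show ?thesis using par wN by simp
      qed
      then show "\<exists>R. half_pt H' (A \<union> T \<union> Q) = half_pt {e \<in> H. e \<inter> N = {}} (A \<union> R) \<and>
          R \<subseteq> {e \<in> H. e \<inter> N \<noteq> {}} \<and> (\<forall>u\<in>N. odd (card {e \<in> A \<union> R. u \<in> e}))"
        using sub unfolding H'_def Un_assoc by (intro exI[of _ "T \<union> Q"]) blast
    qed
    ultimately show "half_pt {e\<in>H. e \<inter> N' = {}} (A \<union> T) \<in> convex hull ?Y"
      unfolding HS by (rule subsetD[OF hull_mono, rotated])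
  qed
  ultimately show ?case by (rule in_convex_hull_trans)
qed

text \<open>A minimal set \<open>S\<close> with the right parities has at most \<open>t\<close> elements. Otherwise two of its more than
  \<open>2 ^ t\<close> subsets have the same parity vector, and removing their symmetric difference from \<open>S\<close> changes
  no parity.\<close>

lemma even_sum_of_few:
  fixes p :: "nat \<Rightarrow> 'e \<Rightarrow> int"
  assumes "finite H"
  shows "\<exists>S\<subseteq>H. card S \<le> t \<and> (\<forall>j\<in>{1..t}. even (\<Sum>e\<in>H - S. p j e))"
proof -
  define ok where "ok S \<longleftrightarrow> S \<subseteq> H \<and> (\<forall>j\<in>{1..t}. even (\<Sum>e\<in>H - S. p j e))" for S
  have "ok H" by (simp add: ok_def)
  then obtain S where S: "ok S" and min: "\<And>S'. ok S' \<Longrightarrow> card S \<le> card S'"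
    using ex_has_least_nat[of ok H card] by blast
  have SH: "S \<subseteq> H" and fS: "finite S" using S assms finite_subset by (auto simp: ok_def)
  have "card S \<le> t"
  proof (rule ccontr)
    assume "\<not> card S \<le> t"
    define g where "g Q = {j\<in>{1..t}. odd (\<Sum>e\<in>Q. p j e)}" for Q
    have "card (g ` Pow S) \<le> card (Pow {1..t})"
      by (intro card_mono) (auto simp: g_def)
    also have "\<dots> < card (Pow S)"
      using \<open>\<not> card S \<le> t\<close> fS by (simp add: card_Pow)
    finally have "\<not> inj_on g (Pow S)" by (rule pigeonhole)
    then obtain Q R where QR: "Q \<subseteq> S" "R \<subseteq> S" "Q \<noteq> R" "g Q = g R"
      by (auto simp: inj_on_def)
    define Z where "Z = (Q - R) \<union> (R - Q)"
    have Z: "Z \<subseteq> S" "Z \<noteq> {}" using QR by (auto simp: Z_def)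
    have fin: "finite Q" "finite R" "finite Z"
      using finite_subset[OF _ fS] QR(1,2) Z(1) by blast+
    have evenZ: "even (\<Sum>e\<in>Z. p j e)" if "j \<in> {1..t}" for j
    proof -
      have "(\<Sum>e\<in>Q. p j e) = (\<Sum>e\<in>Q - R. p j e) + (\<Sum>e\<in>Q \<inter> R. p j e)"
        using sum.Int_Diff[OF fin(1), of "p j" R] by simp
      moreover have "(\<Sum>e\<in>R. p j e) = (\<Sum>e\<in>R - Q. p j e) + (\<Sum>e\<in>Q \<inter> R. p j e)"
        using sum.Int_Diff[OF fin(2), of "p j" Q] by (simp add: Int_commute)
      moreover have "(\<Sum>e\<in>Z. p j e) = (\<Sum>e\<in>Q - R. p j e) + (\<Sum>e\<in>R - Q. p j e)"
        unfolding Z_def using fin by (intro sum.union_disjoint) auto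
      moreover have "odd (\<Sum>e\<in>Q. p j e) = odd (\<Sum>e\<in>R. p j e)"
        using QR(4) that unfolding g_def by blast
      ultimately show ?thesis by presburger
    qed
    have "ok (S - Z)"
      unfolding ok_def
    proof (intro conjI ballI)
      show "S - Z \<subseteq> H" using SH by auto
      fix j assume j: "j \<in> {1..t}"
      have "H - (S - Z) = (H - S) \<union> Z" using SH Z by auto
      then have "(\<Sum>e\<in>H - (S - Z). p j e) = (\<Sum>e\<in>H - S. p j e) + (\<Sum>e\<in>Z. p j e)"
        using assms fin(3) Z(1) by (simp only:) (intro sum.union_disjoint, auto)
      then show "even (\<Sum>e\<in>H - (S - Z). p j e)"
        using S j evenZ[OF j] by (simp add: ok_def)
    qed
    then have "card S \<le> card (S - Z)" by (rule min)
    moreover have "card (S - Z) < card S"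
      using Z fS by (intro psubset_card_mono) auto
    ultimately show False by simp
  qed
  then show ?thesis using S unfolding ok_def by blast
qed

lemma int_inner_half_pt:
  assumes "finite E" "H \<subseteq> E" "A \<subseteq> E" "even (\<Sum>e\<in>H. \<pi> e)"
  shows "int_inner E \<pi> (half_pt H A) \<in> \<int>"
proof -
  have fin: "finite H" "finite A" using assms finite_subset by auto
  have "int_inner E \<pi> (half_pt H A) =
      (\<Sum>e\<in>E. (if e \<in> H then of_int (\<pi> e) / 2 else 0) + of_int (if e \<in> A - H then \<pi> e else 0))"
    unfolding int_inner_def by (intro sum.cong) (auto simp: lookup_half_pt[OF fin])
  also have "\<dots> = of_int (\<Sum>e\<in>H. \<pi> e) / 2 + of_int (\<Sum>e\<in>E. if e \<in> A - H then \<pi> e else 0)"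
    using assms(1,2)
    by (simp add: sum.distrib sum.inter_restrict[symmetric] sum_divide_distrib Int_absorb1)
  also have "\<dots> \<in> \<int>"
  proof -
    obtain z where "(\<Sum>e\<in>H. \<pi> e) = 2 * z" using assms(4) by blast
    then have "real_of_int (\<Sum>e\<in>H. \<pi> e) / 2 = of_int z" by simp
    then show ?thesis by (simp only: Ints_of_int Ints_add)
  qed
  finally show ?thesis .
qed

section \<open>Incidence counting in simple graphs\<close>

lemma simple_graph_finite:
  assumes "simple_graph V E" shows "finite V" "finite E"
proof -
  show "finite V" using assms by (simp add: simple_graph_def)
  moreover have "E \<subseteq> Pow V" using assms by (auto simp: simple_graph_def)
  ultimately show "finite E" using finite_subset by blast
qed

lemma simple_graph_edge:
  assumes "simple_graph V E" "e \<in> E" "u \<in> e"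
  obtains v where "e = {u, v}" "u \<noteq> v" "u \<in> V" "v \<in> V"
proof -
  have "card e = 2" "e \<subseteq> V" using assms by (auto simp: simple_graph_def)
  then show ?thesis using that assms(3) by (auto simp: card_2_iff)
qed

lemma card_nbrs_filter:
  assumes "simple_graph V E"
  shows "card {v \<in> nbrs V E u. Q {u, v}} = card {e\<in>E. u \<in> e \<and> Q e}"
proof (rule bij_betw_same_card)
  show "bij_betw (\<lambda>v. {u, v}) {v \<in> nbrs V E u. Q {u, v}} {e\<in>E. u \<in> e \<and> Q e}"
    unfolding bij_betw_def
  proof
    show "inj_on (\<lambda>v. {u, v}) {v \<in> nbrs V E u. Q {u, v}}"
      by (auto simp: inj_on_def doubleton_eq_iff)
    show "(\<lambda>v. {u, v}) ` {v \<in> nbrs V E u. Q {u, v}} = {e\<in>E. u \<in> e \<and> Q e}"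
    proof (intro equalityI subsetI)
      fix e assume e: "e \<in> {e\<in>E. u \<in> e \<and> Q e}"
      then obtain v where "e = {u, v}" "v \<in> V" using simple_graph_edge[OF assms] by blast
      then show "e \<in> (\<lambda>v. {u, v}) ` {v \<in> nbrs V E u. Q {u, v}}"
        using e by (auto simp: nbrs_def)
    qed (auto simp: nbrs_def)
  qed
qed

lemma card_incident:
  assumes "simple_graph V E" "regular_graph V E d" "u \<in> V"
  shows "card {e\<in>E. u \<in> e} = d"
  using card_nbrs_filter[OF assms(1), of u "\<lambda>_. True"] assms(2,3) by (simp add: regular_graph_def)

lemma sum_incident_inside:
  assumes "finite F" "finite W" "\<And>e. e \<in> F \<Longrightarrow> card e = 2 \<and> e \<subseteq> W"
  shows "(\<Sum>u\<in>W. card {e\<in>F. u \<in> e}) = 2 * card F"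
proof (rule sum_multicount)
  show "\<forall>e\<in>F. card {u \<in> W. u \<in> e} = 2"
  proof
    fix e assume "e \<in> F"
    then have "{u \<in> W. u \<in> e} = e" "card e = 2" using assms(3) by auto
    then show "card {u \<in> W. u \<in> e} = 2" by simp
  qed
qed (use assms in auto)


section \<open>Half-integral and integral points of the Tseitin polytope\<close>

text \<open>Two edges of value \<open>1/2\<close> already contribute \<open>1\<close> to every inequality at their common end point. If
  all edges at a vertex are integral, then the only violated inequality would be the one whose set
  \<open>F\<close> consists of the edges of value \<open>1\<close>, and that set has odd size.\<close>

lemma half_pt_in_tseitin:
  assumes G: "simple_graph V E" and "H \<subseteq> E" "A \<subseteq> E" "H \<inter> A = {}"
    and deg: "\<And>u. u \<in> V \<Longrightarrow> 2 \<le> card {e\<in>H. u \<in> e} \<or>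
        ({e\<in>H. u \<in> e} = {} \<and> odd (card {e\<in>A. u \<in> e}))"
  shows "half_pt H A \<in> tseitin_polytope V E"
proof -
  note finE = simple_graph_finite(2)[OF G] and finV = simple_graph_finite(1)[OF G]
  have fin: "finite H" "finite A" using finE assms finite_subset by auto
  let ?x = "Poly_Mapping.lookup (half_pt H A)"
  have x: "?x e = (if e \<in> H then 1/2 else if e \<in> A then 1 else 0)" for e
    by (rule lookup_half_pt[OF fin])
  have "Poly_Mapping.keys (half_pt H A) \<subseteq> E"
    using assms(2,3) by (auto simp: in_keys_iff x split: if_splits)
  moreover have "1 \<le> (\<Sum>v\<in>nbrs V E u - F. ?x {u, v}) + (\<Sum>v\<in>F. 1 - ?x {u, v})"
    if u: "u \<in> V" and F: "F \<subseteq> nbrs V E u" "even (card F)" for u F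
  proof -
    have fN: "finite (nbrs V E u)" using finV by (simp add: nbrs_def)
    define y where "y v = (if v \<in> F then 1 - ?x {u, v} else ?x {u, v})" for v
    have y0: "0 \<le> y v" for v by (simp add: y_def x)
    have yhalf: "y v = 1/2" if "{u, v} \<in> H" for v using that by (simp add: y_def x)
    have sum: "(\<Sum>v\<in>nbrs V E u - F. ?x {u, v}) + (\<Sum>v\<in>F. 1 - ?x {u, v}) = (\<Sum>v\<in>nbrs V E u. y v)"
      using sum.subset_diff[OF F(1) fN, of y] by (simp add: y_def)
    have "1 \<le> (\<Sum>v\<in>nbrs V E u. y v)"
    proof (cases "2 \<le> card {e\<in>H. u \<in> e}")
      case True
      let ?Z = "{v \<in> nbrs V E u. {u, v} \<in> H}"
      have "card ?Z = card {e\<in>E. u \<in> e \<and> e \<in> H}" by (rule card_nbrs_filter[OF G])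
      also have "{e\<in>E. u \<in> e \<and> e \<in> H} = {e\<in>H. u \<in> e}" using assms(2) by auto
      finally have "2 \<le> card ?Z" using True by simp
      then have "1 \<le> (\<Sum>v\<in>?Z. y v)" by (simp add: yhalf)
      also have "\<dots> \<le> (\<Sum>v\<in>nbrs V E u. y v)"
        using fN y0 by (intro sum_mono2) auto
      finally show ?thesis .
    next
      case False
      then have noH: "{e\<in>H. u \<in> e} = {}" and odd: "odd (card {e\<in>A. u \<in> e})" using deg[OF u] by auto
      let ?Z = "{v \<in> nbrs V E u. {u, v} \<in> A}"
      have "card ?Z = card {e\<in>E. u \<in> e \<and> e \<in> A}" by (rule card_nbrs_filter[OF G])
      also have "{e\<in>E. u \<in> e \<and> e \<in> A} = {e\<in>A. u \<in> e}" using assms(3) by auto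
      finally have "?Z \<noteq> F" using odd F(2) by auto
      then obtain v where v: "v \<in> nbrs V E u" "v \<in> F \<longleftrightarrow> {u, v} \<notin> A" using F(1) by auto
      then have "y v = 1" using noH by (auto simp: y_def x)
      then show ?thesis using member_le_sum[of v "nbrs V E u" y] v(1) fN y0 by simp
    qed
    then show ?thesis using sum by simp
  qed
  moreover have "0 \<le> ?x e \<and> ?x e \<le> 1" for e by (simp add: x)
  ultimately show ?thesis by (simp add: tseitin_polytope_def coord_space_def)
qed

lemma tseitin_ineq:
  assumes "x \<in> tseitin_polytope V E" "u \<in> V" "F \<subseteq> nbrs V E u" "even (card F)"
  shows "1 \<le> (\<Sum>v\<in>nbrs V E u - F. Poly_Mapping.lookup x {u, v})
             + (\<Sum>v\<in>F. 1 - Poly_Mapping.lookup x {u, v})"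
  using assms by (simp add: tseitin_polytope_def)

text \<open>An integral point is the indicator of a set of edges with odd degree at each of an odd number of
  vertices, against the handshake lemma.\<close>

lemma tseitin_integer_hull_empty:
  assumes G: "simple_graph V E" and "odd (card V)"
  shows "integer_hull E (tseitin_polytope V E) = {}"
proof -
  note finE = simple_graph_finite(2)[OF G] and finV = simple_graph_finite(1)[OF G]
  have False if x: "x \<in> tseitin_polytope V E" "\<forall>e\<in>E. Poly_Mapping.lookup x e \<in> \<int>" for x
  proof -
    let ?x = "Poly_Mapping.lookup x"
    define A where "A = {e\<in>E. ?x e = 1}"
    have bin: "?x e = 0 \<or> ?x e = 1" if "e \<in> E" for e
    proof -
      obtain z :: int where z: "?x e = of_int z" using \<open>e \<in> E\<close> x(2) by (auto elim: Ints_cases)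
      moreover have "0 \<le> ?x e" "?x e \<le> 1" using x(1) that by (auto simp: tseitin_polytope_def)
      ultimately show ?thesis by simp linarith
    qed
    have odd: "odd (card {e\<in>A. u \<in> e})" if u: "u \<in> V" for u
    proof
      let ?F = "{v \<in> nbrs V E u. {u, v} \<in> A}"
      assume "even (card {e\<in>A. u \<in> e})"
      moreover have "card ?F = card {e\<in>E. u \<in> e \<and> e \<in> A}" by (rule card_nbrs_filter[OF G])
      moreover have "{e\<in>E. u \<in> e \<and> e \<in> A} = {e\<in>A. u \<in> e}" by (auto simp: A_def)
      ultimately have "even (card ?F)" by simp
      then have "1 \<le> (\<Sum>v\<in>nbrs V E u - ?F. ?x {u, v}) + (\<Sum>v\<in>?F. 1 - ?x {u, v})"
        by (intro tseitin_ineq[OF x(1) u]) auto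
      also have "(\<Sum>v\<in>nbrs V E u - ?F. ?x {u, v}) = 0"
      proof (intro sum.neutral ballI)
        fix v assume "v \<in> nbrs V E u - ?F"
        then have "{u, v} \<in> E" "{u, v} \<notin> A" by (auto simp: nbrs_def)
        then show "?x {u, v} = 0" using bin by (auto simp: A_def)
      qed
      also have "(\<Sum>v\<in>?F. 1 - ?x {u, v}) = 0" by (intro sum.neutral) (auto simp: A_def)
      finally show False by simp
    qed
    have "(\<Sum>u\<in>V. card {e\<in>A. u \<in> e}) = 2 * card A"
      using G finE finV by (intro sum_incident_inside) (auto simp: A_def simple_graph_def)
    moreover have "odd (\<Sum>u\<in>V. card {e\<in>A. u \<in> e})"
      using odd assms(2) finV by (subst even_sum_iff) (auto simp: Collect_conv_if cong: conj_cong)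
    ultimately show False by simp
  qed
  then show ?thesis by (auto simp: integer_hull_def)
qed


section \<open>The rank bound for locally sparse regular graphs\<close>

locale sparse_regular_graph =
  fixes V :: "'v set" and E :: "'v set set" and d c M :: nat
  assumes graph: "simple_graph V E" and regular: "regular_graph V E d"
    and sparse: "\<And>W. W \<subseteq> V \<Longrightarrow> card W \<le> M \<Longrightarrow> card {e\<in>E. e \<subseteq> W} \<le> c * card W"
begin

lemma finV: "finite V" and finE: "finite E"
  using simple_graph_finite[OF graph] .

lemma edge_card: "e \<in> E \<Longrightarrow> card e = 2" and edge_sub: "e \<in> E \<Longrightarrow> e \<subseteq> V"
  using graph by (auto simp: simple_graph_def)

text \<open>The vertices in \<open>D\<close> are the settled ones, and \<open>B\<close> is the set of edges rounded for the sake of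
  integrality. A vertex is settled when fewer than \<open>\<tau>\<close> of its edges are untouched; its other edges,
  more than \<open>d - \<tau>\<close> in number, are charged to vertices settled earlier or to \<open>B\<close>. The edges
  of \<open>B\<close> are counted when they first meet \<open>D\<close>, so each is charged at most once.\<close>

definition charged :: "nat \<Rightarrow> 'v set set \<Rightarrow> 'v set \<Rightarrow> bool" where
  "charged \<tau> B D \<longleftrightarrow> D \<subseteq> V \<and> card D \<le> M \<and>
     d * card D \<le> \<tau> * card D + card {e\<in>E. e \<subseteq> D} + card {e\<in>B. e \<inter> D \<noteq> {}}"

lemma charged_small:
  assumes "charged \<tau> B D" "finite B" "\<tau> + c + 1 \<le> d"
  shows "card D \<le> card B"
proof -
  have "(\<tau> + c + 1) * card D \<le> d * card D" using assms(3) by (rule mult_right_mono) simp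
  also have "\<dots> \<le> \<tau> * card D + c * card D + card {e\<in>B. e \<inter> D \<noteq> {}}"
    using assms(1) sparse[of D] by (auto simp: charged_def)
  also have "card {e\<in>B. e \<inter> D \<noteq> {}} \<le> card B" using assms(2) by (intro card_mono) auto
  finally show ?thesis by (simp add: algebra_simps)
qed

text \<open>A maximal charged extension of \<open>D\<close> leaves no vertex of low degree, since such a vertex could be
  added. The size limit \<open>M\<close> does not prevent this: by \<open>charged_small\<close> the extension has at most
  \<open>card B < M\<close> vertices.\<close>

lemma extend_charged:
  assumes ch: "charged \<tau> B D" and B: "B \<subseteq> E" "card B < M" and d: "\<tau> + c + 1 \<le> d"
  obtains D' where "D \<subseteq> D'" "charged \<tau> B D'"
    "\<And>u. u \<in> V - D' \<Longrightarrow> \<tau> \<le> card {e\<in>E - B. e \<inter> D' = {} \<and> u \<in> e}"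
proof -
  have finB: "finite B" using B(1) finE finite_subset by blast
  define ok where "ok D' \<longleftrightarrow> D \<subseteq> D' \<and> charged \<tau> B D'" for D'
  have "ok D" using ch by (simp add: ok_def)
  moreover have "\<forall>D'. ok D' \<longrightarrow> card D' < Suc M" by (simp add: ok_def charged_def less_Suc_eq_le)
  ultimately have "\<exists>D'. ok D' \<and> (\<forall>D''. ok D'' \<longrightarrow> card D'' \<le> card D')"
    by (rule ex_has_greatest_nat)
  then obtain D' where D': "ok D'" and max: "\<And>D''. ok D'' \<Longrightarrow> card D'' \<le> card D'" by blast
  have D'V: "D' \<subseteq> V" and finD: "finite D'" using D' finV finite_subset by (auto simp: ok_def charged_def)
  have "\<tau> \<le> card {e\<in>E - B. e \<inter> D' = {} \<and> u \<in> e}" if u: "u \<in> V - D'" for u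
  proof (rule ccontr)
    assume low: "\<not> ?thesis"
    let ?D = "insert u D'"
    let ?a = "{e\<in>E. u \<in> e \<and> e \<inter> D' \<noteq> {}}" and ?b = "{e\<in>B. e \<inter> D' = {} \<and> u \<in> e}"
      and ?r = "{e\<in>E - B. e \<inter> D' = {} \<and> u \<in> e}"
    have "d = card {e\<in>E. u \<in> e}" using card_incident[OF graph regular] u by simp
    also have "{e\<in>E. u \<in> e} = ?a \<union> (?b \<union> ?r)" using B(1) by auto
    also have "card \<dots> = card ?a + (card ?b + card ?r)"
      using finE finB by (subst card_Un_disjoint; (subst card_Un_disjoint)?) auto
    finally have deg: "d = card ?a + (card ?b + card ?r)" .
    have "card {e\<in>E. e \<subseteq> D'} + card ?a = card ({e\<in>E. e \<subseteq> D'} \<union> ?a)"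
      using finE u by (subst card_Un_disjoint) auto
    also have "\<dots> \<le> card {e\<in>E. e \<subseteq> ?D}"
    proof (rule card_mono)
      show "{e\<in>E. e \<subseteq> D'} \<union> ?a \<subseteq> {e\<in>E. e \<subseteq> ?D}"
      proof
        fix e assume e: "e \<in> {e\<in>E. e \<subseteq> D'} \<union> ?a"
        show "e \<in> {e\<in>E. e \<subseteq> ?D}"
        proof (cases "u \<in> e")
          case True
          then obtain v where "e = {u, v}" using simple_graph_edge[OF graph] e by blast
          then show ?thesis using e u by auto
        qed (use e in auto)
      qed
    qed (use finE in auto)
    finally have inside: "card {e\<in>E. e \<subseteq> D'} + card ?a \<le> card {e\<in>E. e \<subseteq> ?D}" .
    have "card {e\<in>B. e \<inter> D' \<noteq> {}} + card ?b = card ({e\<in>B. e \<inter> D' \<noteq> {}} \<union> ?b)"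
      using finB by (subst card_Un_disjoint) auto
    also have "\<dots> = card {e\<in>B. e \<inter> ?D \<noteq> {}}"
      by (rule arg_cong[of _ _ card]) auto
    finally have touch: "card {e\<in>B. e \<inter> D' \<noteq> {}} + card ?b = card {e\<in>B. e \<inter> ?D \<noteq> {}}" .
    have card: "card ?D = Suc (card D')" using finD u by simp
    have "card D' \<le> card B" using D' finB d by (intro charged_small) (auto simp: ok_def)
    then have le: "card ?D \<le> M" using card B(2) by linarith
    have "d \<le> card ?a + card ?b + \<tau>" using deg low by linarith
    moreover have "d * card D' \<le> \<tau> * card D' + card {e\<in>E. e \<subseteq> D'} + card {e\<in>B. e \<inter> D' \<noteq> {}}"
      using D' by (simp add: ok_def charged_def)
    moreover have "d * card ?D = d * card D' + d" "\<tau> * card ?D = \<tau> * card D' + \<tau>"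
      by (simp_all add: card)
    ultimately have "d * card ?D \<le> \<tau> * card ?D + card {e\<in>E. e \<subseteq> ?D} + card {e\<in>B. e \<inter> ?D \<noteq> {}}"
      using inside touch by linarith
    then have "ok ?D"
      using le u D'V D' unfolding ok_def charged_def by blast
    then show False using max[of ?D] card by simp
  qed
  then show ?thesis using that D' by (auto simp: ok_def)
qed

text \<open>If every vertex of \<open>W\<close> had at most one edge of \<open>H\<close> leaving \<open>W\<close>, then each would have at least
  \<open>2 * c + 1\<close> edges inside \<open>W\<close>, so \<open>W\<close> would span more than \<open>c * card W\<close> edges.\<close>

lemma many_leaving_edges:
  assumes W: "W \<subseteq> V" "W \<noteq> {}" "card W \<le> M" and "H \<subseteq> E"
    and deg: "\<And>u. u \<in> W \<Longrightarrow> 2 * c + 2 \<le> card {e\<in>H. u \<in> e}"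
  shows "\<exists>u\<in>W. 2 \<le> card {e\<in>H. e \<inter> W = {u}}"
proof (rule ccontr)
  assume none: "\<not> ?thesis"
  have finW: "finite W" and finH: "finite H" using W finV assms(4) finE finite_subset by auto
  have "2 * c + 1 \<le> card {e\<in>{e\<in>H. e \<subseteq> W}. u \<in> e}" if u: "u \<in> W" for u
  proof -
    have "{e\<in>H. u \<in> e} \<subseteq> {e\<in>H. e \<inter> W = {u}} \<union> {e\<in>{e\<in>H. e \<subseteq> W}. u \<in> e}"
    proof
      fix e assume e: "e \<in> {e\<in>H. u \<in> e}"
      then obtain v where "e = {u, v}" using simple_graph_edge[OF graph] assms(4) by blast
      then show "e \<in> {e\<in>H. e \<inter> W = {u}} \<union> {e\<in>{e\<in>H. e \<subseteq> W}. u \<in> e}" using e u by auto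
    qed
    then have "card {e\<in>H. u \<in> e} \<le> card ({e\<in>H. e \<inter> W = {u}} \<union> {e\<in>{e\<in>H. e \<subseteq> W}. u \<in> e})"
      using finH by (intro card_mono) auto
    also have "\<dots> \<le> card {e\<in>H. e \<inter> W = {u}} + card {e\<in>{e\<in>H. e \<subseteq> W}. u \<in> e}"
      by (rule card_Un_le)
    finally have "card {e\<in>H. u \<in> e} \<le> card {e\<in>H. e \<inter> W = {u}} + card {e\<in>{e\<in>H. e \<subseteq> W}. u \<in> e}" .
    moreover have "card {e\<in>H. e \<inter> W = {u}} \<le> 1" using none u by force
    ultimately show ?thesis using deg[OF u] by linarith
  qed
  then have "(\<Sum>u\<in>W. 2 * c + 1) \<le> (\<Sum>u\<in>W. card {e\<in>{e\<in>H. e \<subseteq> W}. u \<in> e})" by (intro sum_mono) auto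
  also have "\<dots> = 2 * card {e\<in>H. e \<subseteq> W}"
    using finH finW assms(4) edge_card by (intro sum_incident_inside) auto
  also have "card {e\<in>H. e \<subseteq> W} \<le> card {e\<in>E. e \<subseteq> W}"
    using assms(4) finE by (intro card_mono) auto
  also have "\<dots> \<le> c * card W" using W by (intro sparse) auto
  finally have "(2 * c + 1) * card W \<le> 2 * (c * card W)" by (simp add: mult.commute)
  then have "card W = 0" by (simp add: algebra_simps)
  then show False using W(2) finW by simp
qed

text \<open>The invariant after \<open>k\<close> rounds: the vertices in \<open>D\<close> are settled with odd parity, at most \<open>t\<close> further
  edges were rounded per round, and every other vertex still has \<open>2 * c + 2\<close> edges of value \<open>1/2\<close>, as
  many as \<open>many_leaving_edges\<close> asks for. The threshold for settling is larger by \<open>t\<close>,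
  because the next round may take up to \<open>t\<close> edges away from one vertex.\<close>

definition position :: "nat \<Rightarrow> nat \<Rightarrow> 'v set set \<Rightarrow> 'v set set \<Rightarrow> bool" where
  "position t k H A \<longleftrightarrow> (\<exists>D B. charged (2 * c + 2 + t) B D \<and> B \<subseteq> E \<and> card B \<le> t * k \<and>
     H = {e\<in>E. e \<inter> D = {}} - B \<and> A \<subseteq> E \<and> H \<inter> A = {} \<and>
     (\<forall>u\<in>D. odd (card {e\<in>A. u \<in> e})) \<and>
     (\<forall>u\<in>V - D. 2 * c + 2 \<le> card {e\<in>H. u \<in> e}))"

lemma position_start:
  assumes "2 * c + 2 \<le> d"
  shows "position t 0 E {}"
proof -
  have "\<forall>u\<in>V. card {e\<in>E. u \<in> e} = d" using card_incident[OF graph regular] by blast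
  then show ?thesis
    unfolding position_def charged_def using assms by (intro exI[of _ "{}"]) auto
qed

lemma position_in_tseitin:
  assumes "position t k H A"
  shows "half_pt H A \<in> tseitin_polytope V E"
proof -
  obtain D B where *: "H = {e\<in>E. e \<inter> D = {}} - B" "A \<subseteq> E" "H \<inter> A = {}"
     "\<forall>u\<in>D. odd (card {e\<in>A. u \<in> e})" "\<forall>u\<in>V - D. 2 * c + 2 \<le> card {e\<in>H. u \<in> e}"
    using assms unfolding position_def by blast
  show ?thesis
  proof (rule half_pt_in_tseitin[OF graph])
    fix u assume "u \<in> V"
    show "2 \<le> card {e\<in>H. u \<in> e} \<or> ({e\<in>H. u \<in> e} = {} \<and> odd (card {e\<in>A. u \<in> e}))"
    proof (cases "u \<in> D")
      case True
      then have "{e\<in>H. u \<in> e} = {}" by (auto simp: *(1))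
      then show ?thesis using True *(4) by simp
    next
      case False
      then have "2 * c + 2 \<le> card {e\<in>H. u \<in> e}" using *(5) \<open>u \<in> V\<close> by blast
      then show ?thesis by linarith
    qed
  qed (use * in auto)
qed

text \<open>One round. The vertices of low degree are settled first and the set \<open>S\<close> is chosen afterwards among
  the edges that remain at \<open>1/2\<close>. The order matters: settling may round edges that the given vectors
  weigh, whereas \<open>S\<close> need not contain more than \<open>t\<close> edges whatever was rounded before.\<close>

lemma position_step:
  fixes \<pi> :: "nat \<Rightarrow> 'v set \<Rightarrow> int"
  assumes pos: "position t k H A" and k: "t * k < M" and d: "3 * c + t + 3 \<le> d"
  shows "half_pt H A \<in> convex hull {half_pt H' A' | H' A'. position t (Suc k) H' A' \<and>
      (\<forall>j\<in>{1..t}. int_inner E (\<pi> j) (half_pt H' A') \<in> \<int>)}"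
    (is "_ \<in> convex hull ?Y")
proof -
  let ?\<tau> = "2 * c + 2 + t"
  obtain D B where ch: "charged ?\<tau> B D" and B: "B \<subseteq> E" "card B \<le> t * k"
    and H: "H = {e\<in>E. e \<inter> D = {}} - B" and A: "A \<subseteq> E" "H \<inter> A = {}"
    and odd: "\<forall>u\<in>D. odd (card {e\<in>A. u \<in> e})"
    and deg: "\<forall>u\<in>V - D. 2 * c + 2 \<le> card {e\<in>H. u \<in> e}"
    using pos unfolding position_def by blast
  obtain D' where D': "D \<subseteq> D'" and ch': "charged ?\<tau> B D'"
    and deg': "\<And>u. u \<in> V - D' \<Longrightarrow> ?\<tau> \<le> card {e\<in>E - B. e \<inter> D' = {} \<and> u \<in> e}"
    using extend_charged[OF ch B(1)] B(2) k d by auto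
  have D'V: "D' \<subseteq> V" "card D' \<le> M" using ch' by (auto simp: charged_def)
  have finD': "finite D'" using D'V finV finite_subset by blast
  have HE: "H \<subseteq> E" using H by auto
  have fin: "finite H" "finite A" "finite B"
    using finite_subset[OF _ finE] HE A(1) B(1) by blast+
  define N where "N = D' - D"
  define H1 where "H1 = {e\<in>H. e \<inter> N = {}}"
  have H1: "H1 = {e\<in>E. e \<inter> D' = {}} - B" using D' by (auto simp: H1_def N_def H)
  have H1E: "H1 \<subseteq> E" and finH1: "finite H1" using HE fin by (auto simp: H1_def)
  obtain S where S: "S \<subseteq> H1" "card S \<le> t" "\<forall>j\<in>{1..t}. even (\<Sum>e\<in>H1 - S. \<pi> j e)"
    using even_sum_of_few[OF finH1, of t \<pi>] by blast
  have finS: "finite S" using S(1) finH1 finite_subset by blast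
  let ?Z = "{half_pt {e\<in>H. e \<inter> N = {}} (A \<union> T) | T. T \<subseteq> {e\<in>H. e \<inter> N \<noteq> {}} \<and>
        (\<forall>u\<in>N. odd (card {e \<in> A \<union> T. u \<in> e}))}"
  have "half_pt H A \<in> convex hull ?Z"
  proof (rule half_pt_settle_vertices)
    fix W assume W: "W \<subseteq> N" "W \<noteq> {}"
    have "card W \<le> card D'" using W(1) finD' by (intro card_mono) (auto simp: N_def)
    then show "\<exists>u\<in>W. 2 \<le> card {e\<in>H. e \<inter> W = {u}}"
      using W D'V deg HE by (intro many_leaving_edges) (auto simp: N_def)
  qed (use fin A finD' in \<open>auto simp: N_def\<close>)
  moreover have "?Z \<subseteq> convex hull ?Y"
  proof clarify
    fix T assume T: "T \<subseteq> {e\<in>H. e \<inter> N \<noteq> {}}" and oddN: "\<forall>u\<in>N. odd (card {e \<in> A \<union> T. u \<in> e})"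
    have finT: "finite T" using T fin finite_subset by fastforce
    have TE: "A \<union> T \<subseteq> E" using T HE A by auto
    have oddD': "odd (card {e \<in> A \<union> T. u \<in> e})" if "u \<in> D'" for u
    proof (cases "u \<in> N")
      case False
      then have uD: "u \<in> D" using that by (simp add: N_def)
      then have "{e \<in> A \<union> T. u \<in> e} = {e\<in>A. u \<in> e}" using T H by auto
      then show ?thesis using odd uD by simp
    qed (use oddN in auto)
    have "half_pt ((H1 - S) \<union> S) (A \<union> T) \<in> convex hull {half_pt (H1 - S) ((A \<union> T) \<union> Q) | Q. Q \<subseteq> S}"
      using finS finH1 fin finT S(1) A(2) T by (intro half_pt_fix_set) (auto simp: H1_def)
    moreover have "{half_pt (H1 - S) ((A \<union> T) \<union> Q) | Q. Q \<subseteq> S} \<subseteq> ?Y"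
    proof clarify
      fix Q assume Q: "Q \<subseteq> S"
      have sub: "A \<union> T \<union> Q \<subseteq> E" using TE Q S(1) H1E by auto
      have "position t (Suc k) (H1 - S) (A \<union> T \<union> Q)"
        unfolding position_def
      proof (intro exI[of _ D'] exI[of _ "B \<union> S"] conjI ballI)
        have "card {e\<in>B. e \<inter> D' \<noteq> {}} \<le> card {e\<in>B \<union> S. e \<inter> D' \<noteq> {}}"
          using fin finS by (intro card_mono) auto
        then show "charged ?\<tau> (B \<union> S) D'" using ch' by (auto simp: charged_def)
        show "B \<union> S \<subseteq> E" using B S(1) H1E by auto
        show "card (B \<union> S) \<le> t * Suc k" using card_Un_le[of B S] B(2) S(2) by simp
        show "H1 - S = {e\<in>E. e \<inter> D' = {}} - (B \<union> S)" using H1 by auto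
        show "A \<union> T \<union> Q \<subseteq> E" by (rule sub)
        show "(H1 - S) \<inter> (A \<union> T \<union> Q) = {}" using A(2) T Q by (auto simp: H1_def)
        fix u assume u: "u \<in> D'"
        have "{e \<in> A \<union> T \<union> Q. u \<in> e} = {e \<in> A \<union> T. u \<in> e}" using Q S(1) H1 u by auto
        then show "odd (card {e \<in> A \<union> T \<union> Q. u \<in> e})" using oddD'[OF u] by simp
      next
        fix u assume u: "u \<in> V - D'"
        have "{e\<in>E - B. e \<inter> D' = {} \<and> u \<in> e} \<subseteq> {e\<in>H1 - S. u \<in> e} \<union> S" by (auto simp: H1)
        then have "card {e\<in>E - B. e \<inter> D' = {} \<and> u \<in> e} \<le> card ({e\<in>H1 - S. u \<in> e} \<union> S)"
          using finS finH1 by (intro card_mono) auto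
        also have "\<dots> \<le> card {e\<in>H1 - S. u \<in> e} + card S" by (rule card_Un_le)
        finally show "2 * c + 2 \<le> card {e\<in>H1 - S. u \<in> e}" using deg'[OF u] S(2) by linarith
      qed
      moreover have "\<forall>j\<in>{1..t}. int_inner E (\<pi> j) (half_pt (H1 - S) (A \<union> T \<union> Q)) \<in> \<int>"
        using S(3) finE sub H1E by (intro ballI int_inner_half_pt) auto
      ultimately show "\<exists>H' A'. half_pt (H1 - S) (A \<union> T \<union> Q) = half_pt H' A' \<and>
          position t (Suc k) H' A' \<and> (\<forall>j\<in>{1..t}. int_inner E (\<pi> j) (half_pt H' A') \<in> \<int>)"
        by blast
    qed
    ultimately have "half_pt ((H1 - S) \<union> S) (A \<union> T) \<in> convex hull ?Y"
      by (rule rev_subsetD[OF _ hull_mono])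
    then show "half_pt {e\<in>H. e \<inter> N = {}} (A \<union> T) \<in> convex hull ?Y"
      using S(1) by (simp add: H1_def[symmetric] Un_absorb2)
  qed
  ultimately show ?thesis by (rule in_convex_hull_trans)
qed

lemma position_in_iterated_closure:
  assumes d: "3 * c + t + 3 \<le> d" and t: "1 \<le> t" and "position t k H A" "t * (k + i) \<le> M"
  shows "half_pt H A \<in> (lattice_closure E t ^^ i) (tseitin_polytope V E)"
  using assms(3,4)
proof (induction i arbitrary: k H A)
  case 0
  then show ?case by (simp add: position_in_tseitin)
next
  case (Suc i)
  let ?P = "(lattice_closure E t ^^ i) (tseitin_polytope V E)"
  have "half_pt H A \<in> convex hull (\<Inter>j\<in>{1..t}. {x \<in> ?P. int_inner E (\<pi> j) x \<in> \<int>})" for \<pi>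
  proof -
    have "t * k < M" using Suc.prems(2) t by (simp add: algebra_simps)
    from position_step[OF Suc.prems(1) this d, of \<pi>]
    show ?thesis
    proof (rule rev_subsetD[OF _ hull_mono], clarify)
      fix H' A' j assume "position t (Suc k) H' A'" and *: "\<forall>j\<in>{1..t}. int_inner E (\<pi> j) (half_pt H' A') \<in> \<int>"
        "j \<in> {1..t}"
      then have "half_pt H' A' \<in> ?P" using Suc.prems(2) by (intro Suc.IH) auto
      then show "half_pt H' A' \<in> ?P \<and> int_inner E (\<pi> j) (half_pt H' A') \<in> \<int>" using * by blast
    qed
  qed
  then have "half_pt H A \<in> lattice_closure E t ?P"
    unfolding lattice_closure_def[of E t ?P] by (intro INT_I)
  then show ?case by simp
qed

theorem lattice_rank_ge:
  assumes "3 * c + t + 3 \<le> d" "1 \<le> t" "odd (card V)" "t * K \<le> M"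
  shows "enat (Suc K) \<le> lattice_rank E t (tseitin_polytope V E)"
  unfolding lattice_rank_def
proof (rule Inf_greatest, clarify)
  fix k assume "(lattice_closure E t ^^ k) (tseitin_polytope V E) = integer_hull E (tseitin_polytope V E)"
  then have empty: "(lattice_closure E t ^^ k) (tseitin_polytope V E) = {}"
    using tseitin_integer_hull_empty[OF graph assms(3)] by simp
  have "\<not> k \<le> K"
  proof
    assume "k \<le> K"
    then have "t * (0 + k) \<le> M" using order_trans[OF mult_le_mono2 assms(4)] by simp
    then have "half_pt E {} \<in> (lattice_closure E t ^^ k) (tseitin_polytope V E)"
      using position_in_iterated_closure[OF assms(1,2) position_start] assms(1) by auto
    then show False using empty by simp
  qed
  then show "enat (Suc K) \<le> enat k" by simp
qed

end

section \<open>Counting permutations with prescribed values\<close>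

text \<open>The permutations of a disjoint union of fibers that act on each fiber separately; a single such
  permutation encodes one permutation per fiber, independent of each other.\<close>

definition fiber_perms :: "('a \<times> 'b) set \<Rightarrow> ('a \<times> 'b \<Rightarrow> 'a \<times> 'b) set" where
  "fiber_perms X = {\<sigma>. \<sigma> permutes X \<and> (\<forall>q\<in>X. fst (\<sigma> q) = fst q)}"

definition extending :: "('a \<times> 'b) set \<Rightarrow> (('a \<times> 'b) \<times> ('a \<times> 'b)) set \<Rightarrow> ('a \<times> 'b \<Rightarrow> 'a \<times> 'b) set" where
  "extending X F = {\<sigma> \<in> fiber_perms X. \<forall>z\<in>F. \<sigma> (fst z) = snd z}"

lemma finite_fiber_perms: "finite X \<Longrightarrow> finite (fiber_perms X)"
  using finite_permutations[of X] by (simp add: fiber_perms_def)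

text \<open>Prescribing one more value divides the number of permutations by at least \<open>m - card F\<close>, when fibers
  have at least \<open>m\<close> points: composing with a transposition moves the prescribed value to any other
  point of the fiber that is not yet constrained, and the result determines both the permutation and
  that point.\<close>

lemma card_extending_insert:
  assumes X: "finite X" "fst z \<in> X" "m \<le> card {q\<in>X. fst q = fst (fst z)}"
    and F: "finite F" "z \<notin> F"
  shows "card (extending X (insert z F)) * (m - card F) \<le> card (extending X F)"
proof (cases "extending X (insert z F) = {}")
  case False
  let ?S = "extending X (insert z F)" and ?p = "fst z"
  define A where "A = {q\<in>X. fst q = fst ?p} - fst ` F"
  have p: "?p \<notin> fst ` F"
  proof
    assume "?p \<in> fst ` F"
    then obtain y where y: "y \<in> F" "fst y = fst z" by auto
    obtain \<sigma> where "\<sigma> \<in> ?S" using False by blast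
    then have "snd y = snd z" using y by (auto simp: extending_def)
    then show False using y F(2) by (metis prod_eqI)
  qed
  have "card (fst ` F) \<le> card F" using F(1) by (rule card_image_le)
  then have A: "m - card F \<le> card A"
    unfolding A_def using diff_card_le_card_Diff[of "fst ` F" "{q\<in>X. fst q = fst ?p}"] F(1) X(3)
    by simp
  let ?\<Phi> = "\<lambda>y. fst y \<circ> Transposition.transpose ?p (snd y)"
  have inj: "inj_on ?\<Phi> (?S \<times> A)"
  proof (rule inj_onI)
    fix y y' assume *: "y \<in> ?S \<times> A" "y' \<in> ?S \<times> A" and eq: "?\<Phi> y = ?\<Phi> y'"
    have "fst y' permutes X" using * by (auto simp: extending_def fiber_perms_def)
    then have inj: "inj (?\<Phi> y')" using permutes_inj by (intro inj_compose inj_transpose) auto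
    have "?\<Phi> y' (snd y) = snd z" unfolding eq[symmetric] using * by (auto simp: extending_def)
    moreover have "?\<Phi> y' (snd y') = snd z" using * by (auto simp: extending_def)
    ultimately have q: "snd y = snd y'" using injD[OF inj] by metis
    have "fst y = ?\<Phi> y \<circ> Transposition.transpose ?p (snd y)" by (simp add: comp_assoc)
    also have "\<dots> = fst y'" unfolding eq by (simp add: q comp_assoc)
    finally show "y = y'" using q by (simp add: prod_eqI)
  qed
  have im: "?\<Phi> ` (?S \<times> A) \<subseteq> extending X F"
  proof (rule image_subsetI)
    fix y assume y: "y \<in> ?S \<times> A"
    define \<sigma> q where "\<sigma> = fst y" and "q = snd y"
    have \<sigma>: "\<sigma> permutes X" "\<And>q. q \<in> X \<Longrightarrow> fst (\<sigma> q) = fst q" "\<And>w. w \<in> F \<Longrightarrow> \<sigma> (fst w) = snd w"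
      using y by (auto simp: extending_def fiber_perms_def \<sigma>_def)
    have q: "q \<in> X" "fst q = fst ?p" "q \<notin> fst ` F"
      using y unfolding A_def q_def mem_Times_iff by blast+
    have "(\<sigma> \<circ> Transposition.transpose ?p q) permutes X"
      using \<sigma>(1) q X(2) by (intro permutes_compose permutes_swap_id) auto
    moreover have "fst ((\<sigma> \<circ> Transposition.transpose ?p q) w) = fst w" if "w \<in> X" for w
    proof -
      have "Transposition.transpose ?p q w \<in> X" "fst (Transposition.transpose ?p q w) = fst w"
        using that q X(2) by (auto simp: Transposition.transpose_def)
      then show ?thesis using \<sigma>(2) by simp
    qed
    moreover have "(\<sigma> \<circ> Transposition.transpose ?p q) (fst w) = snd w" if "w \<in> F" for w
    proof -
      have "fst w \<noteq> ?p" "fst w \<noteq> q" using imageI[OF that, of fst] p q(3) by metis+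
      then show ?thesis using \<sigma>(3)[OF that] by simp
    qed
    ultimately show "?\<Phi> y \<in> extending X F"
      by (simp add: extending_def fiber_perms_def \<sigma>_def q_def)
  qed
  have "card ?S * (m - card F) \<le> card ?S * card A" using A by simp
  also have "\<dots> = card (?\<Phi> ` (?S \<times> A))" using inj by (simp add: card_image card_cartesian_product)
  also have "\<dots> \<le> card (extending X F)"
    using im finite_fiber_perms[OF X(1)] by (intro card_mono) (auto simp: extending_def)
  finally show ?thesis .
qed simp

lemma card_extending:
  assumes "finite F" "finite X" "fst ` F \<subseteq> X" "\<And>p. p \<in> X \<Longrightarrow> m \<le> card {q\<in>X. fst q = fst p}"
    "2 * card F \<le> m"
  shows "card (extending X F) * m ^ card F \<le> 2 ^ card F * card (fiber_perms X)"
  using assms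
proof (induction F rule: finite_induct)
  case empty
  then show ?case by (simp add: extending_def)
next
  case (insert z F)
  have card: "card (insert z F) = Suc (card F)" using insert by simp
  let ?a = "card (extending X (insert z F))"
  have "?a * m \<le> ?a * (2 * (m - card F))"
    using insert.prems(4) card by (intro mult_le_mono2) linarith
  also have "\<dots> \<le> 2 * card (extending X F)"
    using card_extending_insert[of X z m F] insert by simp
  finally have "?a * m * m ^ card F \<le> 2 * card (extending X F) * m ^ card F"
    by (rule mult_le_mono1)
  also have "\<dots> \<le> 2 * (2 ^ card F * card (fiber_perms X))"
    using insert by (simp add: card)
  finally show ?case by (simp add: card mult.assoc)
qed

lemma power_self_le_fact: "n ^ n \<le> 3 ^ n * (fact n :: nat)"
proof (induction n)
  case (Suc n)
  show ?case
  proof (cases "n = 0")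
    case False
    have "(1 + 1 / real n) ^ n \<le> exp 1"
      using exp_ge_one_plus_x_over_n_power_n[of n 1] False by simp
    also have "\<dots> \<le> 3" by (rule exp_le)
    finally have "(1 + 1 / real n) ^ n * real n ^ n \<le> 3 * real n ^ n"
      by (rule mult_right_mono) simp
    then have "((1 + 1 / real n) * real n) ^ n \<le> 3 * real n ^ n" by (simp add: power_mult_distrib)
    moreover have "(1 + 1 / real n) * real n = real (Suc n)" using False by (simp add: field_simps)
    ultimately have "real (Suc n ^ n) \<le> real (3 * n ^ n)" by simp
    then have "Suc n ^ n \<le> 3 * n ^ n" by (simp only: of_nat_le_iff)
    then have "Suc n ^ Suc n \<le> Suc n * (3 * n ^ n)" by (simp only: power_Suc mult_le_mono2)
    also have "\<dots> \<le> Suc n * (3 * (3 ^ n * fact n))" using Suc by (intro mult_le_mono2)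
    also have "\<dots> = 3 ^ Suc n * fact (Suc n)" by (simp add: algebra_simps)
    finally show ?thesis .
  qed simp
qed simp

lemma binomial_power_bound: "(n choose k) * k ^ k \<le> (3 * n) ^ k"
proof -
  have "(n choose k) * k ^ k \<le> (n choose k) * (3 ^ k * fact k)"
    by (intro mult_le_mono2 power_self_le_fact)
  also have "\<dots> = 3 ^ k * ((n choose k) * fact k)" by simp
  also have "\<dots> \<le> 3 ^ k * n ^ k" by (intro mult_le_mono2 binomial_fact_pow)
  finally show ?thesis by (simp add: power_mult_distrib)
qed

text \<open>The union bound for vertex sets of size \<open>w\<close> in an \<open>m\<close>-fold lift with \<open>r\<close> fibers: \<open>r * m choose w\<close>
  sets, \<open>w * w choose (2 * w)\<close> sets of \<open>2 * w\<close> possible edges inside, and probability at most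
  \<open>(2 / m) ^ (2 * w)\<close> that all edges of such a set are present. With \<open>k ^ k \<le> 3 ^ k * fact k\<close> the product is at most \<open>(27 * r * w / m) ^ w\<close>;
  the constant \<open>81\<close> makes it at most \<open>(1 / 3) ^ w\<close>.\<close>

lemma union_bound_arith:
  assumes w: "1 \<le> w" "81 * r * w \<le> m"
  shows "3 ^ w * ((r * m choose w) * ((w * w choose (2 * w)) * 2 ^ (2 * w))) \<le> m ^ (2 * w)"
proof -
  let ?a = "r * m choose w" and ?b = "w * w choose (2 * w)"
  let ?z = "w ^ w * (2 * w) ^ (2 * w)"
  have pos: "0 < ?z" using w by simp
  have "3 ^ w * (?a * (?b * 2 ^ (2 * w))) * ?z =
      3 ^ w * 2 ^ (2 * w) * ((?a * w ^ w) * (?b * (2 * w) ^ (2 * w)))" by (simp add: ac_simps)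
  also have "\<dots> \<le> 3 ^ w * 2 ^ (2 * w) * ((3 * (r * m)) ^ w * (3 * (w * w)) ^ (2 * w))"
    by (intro mult_le_mono2 mult_le_mono binomial_power_bound)
  also have "\<dots> = (3 * 2 ^ 2 * (3 * (r * m)) * (3 * (w * w)) ^ 2) ^ w"
    by (simp only: power_mult power_mult_distrib)
  also have "3 * 2 ^ 2 * (3 * (r * m)) * (3 * (w * w)) ^ 2 = (81 * r * w) * (m * (w * (2 * w) ^ 2))"
    by (simp add: power2_eq_square)
  also have "\<dots> ^ w \<le> (m * (m * (w * (2 * w) ^ 2))) ^ w"
    using w by (intro power_mono mult_le_mono1) auto
  also have "\<dots> = m ^ (2 * w) * ?z"
    by (simp only: power_mult_distrib power_mult power2_eq_square ac_simps)
  finally show ?thesis using w(1) by simp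
qed

lemma sum_geometric_third:
  fixes b :: "nat \<Rightarrow> nat"
  assumes "\<And>w. w \<in> {1..k} \<Longrightarrow> 3 ^ w * b w \<le> N" "0 < N"
  shows "(\<Sum>w=1..k. b w) < N"
proof -
  have geo: "(\<Sum>w=1..k. (1/3) ^ w) \<le> (1/2 :: real)"
  proof -
    have "(\<Sum>w=1..k. (1/3) ^ w) = (1 - (1/3) ^ k) / (2 :: real)" by (induction k) auto
    then show ?thesis by simp
  qed
  have "real (\<Sum>w=1..k. b w) \<le> (\<Sum>w=1..k. real N * (1/3) ^ w)"
    unfolding of_nat_sum
  proof (rule sum_mono)
    fix w assume "w \<in> {1..k}"
    then have "real (3 ^ w * b w) \<le> real N" using assms(1) by (simp only: of_nat_le_iff)
    then show "real (b w) \<le> real N * (1/3) ^ w" by (simp add: field_simps power_one_over)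
  qed
  also have "\<dots> = real N * (\<Sum>w=1..k. (1/3) ^ w)" by (simp add: sum_distrib_left)
  also have "\<dots> \<le> real N * (1/2)" using geo by (rule mult_left_mono) simp
  also have "\<dots> < real N" using assms(2) by simp
  finally show ?thesis by (simp only: of_nat_less_iff)
qed

section \<open>Random lifts of complete graphs\<close>

text \<open>The arc \<open>((i, j), x)\<close> with \<open>i < j\<close> starts at the point \<open>x\<close> of the fiber over \<open>i\<close> and leads to the
  fiber over \<open>j\<close>. A permutation of the arcs that fixes \<open>(i, j)\<close> says at which point it ends. As \<open>i < j\<close>,
  lifts have neither loops nor parallel edges.\<close>

type_synonym arc = "(nat \<times> nat) \<times> nat"

definition arcs :: "nat \<Rightarrow> nat \<Rightarrow> arc set" where
  "arcs r m = {q. fst (fst q) < snd (fst q) \<and> snd (fst q) < r \<and> snd q < m}"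

definition tail :: "arc \<Rightarrow> nat" where "tail q = prod_encode (fst (fst q), snd q)"
definition head :: "arc \<Rightarrow> nat" where "head q = prod_encode (snd (fst q), snd q)"

definition lift_verts :: "nat \<Rightarrow> nat \<Rightarrow> nat set" where
  "lift_verts r m = prod_encode ` ({..<r} \<times> {..<m})"

definition lift_edges :: "nat \<Rightarrow> nat \<Rightarrow> (arc \<Rightarrow> arc) \<Rightarrow> nat set set" where
  "lift_edges r m \<sigma> = (\<lambda>q. {tail q, head (\<sigma> q)}) ` arcs r m"

lemma finite_arcs: "finite (arcs r m)"
  by (rule finite_subset[of _ "({..<r} \<times> {..<r}) \<times> {..<m}"]) (auto simp: arcs_def)

lemma lift_verts_finite: "finite (lift_verts r m)"
  and card_lift_verts: "card (lift_verts r m) = r * m"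
  by (simp_all add: lift_verts_def card_image[OF inj_prod_encode] card_cartesian_product)

lemma arcs_fiber: "p \<in> arcs r m \<Longrightarrow> card {q\<in>arcs r m. fst q = fst p} = m"
proof -
  assume "p \<in> arcs r m"
  then have "{q\<in>arcs r m. fst q = fst p} = Pair (fst p) ` {..<m}"
    by (auto simp: arcs_def image_iff)
  then show ?thesis by (simp add: card_image inj_on_def)
qed

lemma fiber_permsD:
  assumes "\<sigma> \<in> fiber_perms X"
  shows "q \<in> X \<Longrightarrow> \<sigma> q \<in> X" "q \<in> X \<Longrightarrow> fst (\<sigma> q) = fst q" "inj \<sigma>"
    "q \<in> X \<Longrightarrow> \<exists>q'\<in>X. \<sigma> q' = q \<and> fst q' = fst q"
proof -
  have s: "\<sigma> permutes X" "\<And>q. q \<in> X \<Longrightarrow> fst (\<sigma> q) = fst q"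
    using assms by (auto simp: fiber_perms_def)
  show "q \<in> X \<Longrightarrow> \<sigma> q \<in> X" "q \<in> X \<Longrightarrow> fst (\<sigma> q) = fst q" "inj \<sigma>"
    using s permutes_in_image[OF s(1)] permutes_inj[OF s(1)] by auto
  assume q: "q \<in> X"
  then obtain q' where "q' \<in> X" "\<sigma> q' = q" using permutes_image[OF s(1)] by (metis imageE)
  then show "\<exists>q'\<in>X. \<sigma> q' = q \<and> fst q' = fst q" using s(2) by metis
qed

lemma lift_simple:
  assumes s: "\<sigma> \<in> fiber_perms (arcs r m)"
  shows "simple_graph (lift_verts r m) (lift_edges r m \<sigma>)"
  unfolding simple_graph_def
proof (intro conjI ballI)
  fix e assume "e \<in> lift_edges r m \<sigma>"
  then obtain q where q: "q \<in> arcs r m" "e = {tail q, head (\<sigma> q)}" by (auto simp: lift_edges_def)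
  have *: "\<sigma> q \<in> arcs r m" "fst (\<sigma> q) = fst q" using fiber_permsD[OF s] q(1) by auto
  show "e \<subseteq> lift_verts r m"
    using q * by (auto simp: arcs_def tail_def head_def lift_verts_def)
  have "tail q \<noteq> head (\<sigma> q)" using q * by (auto simp: arcs_def tail_def head_def)
  then show "card e = 2" using q(2) by simp
qed (rule lift_verts_finite)

text \<open>A vertex over \<open>i\<close> has exactly one neighbor over each \<open>j \<noteq> i\<close>, given by the permutation if \<open>i < j\<close> and
  by its inverse if \<open>j < i\<close>.\<close>

lemma lift_regular:
  assumes s: "\<sigma> \<in> fiber_perms (arcs r m)"
  shows "regular_graph (lift_verts r m) (lift_edges r m \<sigma>) (r - 1)"
  unfolding regular_graph_def
proof
  note D = fiber_permsD[OF s]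
  fix u assume "u \<in> lift_verts r m"
  then obtain i x where u: "u = prod_encode (i, x)" "i < r" "x < m" by (auto simp: lift_verts_def)
  \<comment> \<open>\<open>f j\<close> is the neighbor of \<open>u\<close> over \<open>j\<close>.\<close>
  define f where "f j = (if i < j then head (\<sigma> ((i, j), x)) else tail (SOME q. q \<in> arcs r m \<and> \<sigma> q = ((j, i), x)))" for j
  have above: "f j = head (\<sigma> ((i, j), x)) \<and> ((i, j), x) \<in> arcs r m \<and> fst (prod_decode (f j)) = j"
    if "j < r" "i < j" for j
  proof -
    have "((i, j), x) \<in> arcs r m" using that u by (simp add: arcs_def)
    then show ?thesis using D(2)[of "((i, j), x)"] that by (simp add: f_def head_def)
  qed
  have below: "\<exists>q\<in>arcs r m. f j = tail q \<and> \<sigma> q = ((j, i), x) \<and> fst (prod_decode (f j)) = j"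
    if "j < i" for j
  proof -
    have "((j, i), x) \<in> arcs r m" using that u by (simp add: arcs_def)
    then obtain q where q: "q \<in> arcs r m" "\<sigma> q = ((j, i), x)" "fst q = (j, i)" using D(4) by fastforce
    then have "(SOME q. q \<in> arcs r m \<and> \<sigma> q = ((j, i), x)) = q"
      by (metis (mono_tags, lifting) D(3) injD someI_ex)
    then show ?thesis using q that by (intro bexI[of _ q]) (auto simp: f_def tail_def)
  qed
  have decode: "fst (prod_decode (f j)) = j" if "j \<in> {..<r} - {i}" for j
    using that above[of j] below[of j] by (cases "i < j") auto
  have "nbrs (lift_verts r m) (lift_edges r m \<sigma>) u = f ` ({..<r} - {i})"
  proof (intro equalityI subsetI)
    fix v assume "v \<in> nbrs (lift_verts r m) (lift_edges r m \<sigma>) u"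
    then obtain q where q: "q \<in> arcs r m" "{u, v} = {tail q, head (\<sigma> q)}"
      by (auto simp: nbrs_def lift_edges_def)
    have *: "\<sigma> q \<in> arcs r m" "fst (\<sigma> q) = fst q" using D q(1) by auto
    consider "u = tail q" "v = head (\<sigma> q)" | "u = head (\<sigma> q)" "v = tail q"
      using q(2) by (auto simp: doubleton_eq_iff)
    then show "v \<in> f ` ({..<r} - {i})"
    proof cases
      case 1
      define j where "j = snd (fst q)"
      have "q = ((i, j), x)" using 1 u by (simp add: tail_def j_def prod_eq_iff)
      moreover have "i < j" "j < r" using q(1) calculation by (auto simp: arcs_def)
      ultimately show ?thesis using 1 above[of j] by (intro image_eqI[of _ _ j]) auto
    next
      case 2
      define j where "j = fst (fst q)"
      have sq: "\<sigma> q = ((j, i), x)" using 2 u * by (simp add: head_def j_def prod_eq_iff)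
      moreover have "j < i" using *(1) sq by (simp add: arcs_def)
      moreover obtain q' where "q' \<in> arcs r m" "f j = tail q'" "\<sigma> q' = ((j, i), x)"
        using below[OF \<open>j < i\<close>] by blast
      ultimately have "v = f j" using 2 D(3) by (metis injD)
      then show ?thesis using \<open>j < i\<close> u(2) by (intro image_eqI[of _ _ j]) auto
    qed
  next
    fix v assume "v \<in> f ` ({..<r} - {i})"
    then obtain j where j: "v = f j" "j < r" "j \<noteq> i" by auto
    have "{u, v} \<in> lift_edges r m \<sigma>"
    proof (cases "i < j")
      case True
      then have "((i, j), x) \<in> arcs r m" "{u, v} = {tail ((i, j), x), head (\<sigma> ((i, j), x))}"
        using above j u by (auto simp: tail_def)
      then show ?thesis unfolding lift_edges_def by blast
    next
      case False
      then obtain q where "q \<in> arcs r m" "v = tail q" "\<sigma> q = ((j, i), x)" using below[of j] j by auto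
      moreover from this have "{u, v} = {tail q, head (\<sigma> q)}" using u by (auto simp: head_def)
      ultimately show ?thesis unfolding lift_edges_def by blast
    qed
    moreover from this have "v \<in> lift_verts r m"
      using lift_simple[OF s] by (auto simp: simple_graph_def)
    ultimately show "v \<in> nbrs (lift_verts r m) (lift_edges r m \<sigma>) u" by (simp add: nbrs_def)
  qed
  moreover have "inj_on f ({..<r} - {i})" using decode by (rule inj_on_inverseI)
  ultimately show "card (nbrs (lift_verts r m) (lift_edges r m \<sigma>) u) = r - 1"
    using u(2) by (simp add: card_image)
qed

text \<open>Any \<open>k\<close> of the edges between the fibers over \<open>0\<close> and \<open>1\<close> form a matching.\<close>

lemma lift_matching:
  assumes s: "\<sigma> \<in> fiber_perms (arcs r m)" and r: "2 \<le> r" and k: "k \<le> m"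
  obtains Mt where "Mt \<subseteq> lift_edges r m \<sigma>" "card (\<Union>Mt) = 2 * k" "pairwise disjnt Mt"
proof -
  note D = fiber_permsD[OF s]
  define a :: "nat \<Rightarrow> arc" where "a x = ((0, 1), x)" for x
  have a: "a x \<in> arcs r m" "fst (\<sigma> (a x)) = (0, 1)" if "x < k" for x
  proof -
    show "a x \<in> arcs r m" using that r k by (simp add: a_def arcs_def)
    then show "fst (\<sigma> (a x)) = (0, 1)" using D(2) by (simp add: a_def)
  qed
  let ?e = "\<lambda>x. {tail (a x), head (\<sigma> (a x))}"
  have heads: "head (\<sigma> (a x)) = head (\<sigma> (a y)) \<longleftrightarrow> x = y" if "x < k" "y < k" for x y
  proof
    assume "head (\<sigma> (a x)) = head (\<sigma> (a y))"
    then have "\<sigma> (a x) = \<sigma> (a y)" using a that by (auto simp: head_def prod_eq_iff)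
    then show "x = y" using D(3) by (auto simp: a_def dest: injD)
  qed simp
  have cross: "tail (a x) \<noteq> head (\<sigma> (a y))" if "y < k" for x y
    using a[OF that] by (simp add: tail_def head_def a_def)
  have tails: "tail (a x) = tail (a y) \<longleftrightarrow> x = y" for x y by (simp add: tail_def a_def)
  have "\<Union> (?e ` {..<k}) = (\<lambda>x. tail (a x)) ` {..<k} \<union> (\<lambda>x. head (\<sigma> (a x))) ` {..<k}" by auto
  also have "card \<dots> = k + k"
    using tails heads cross by (subst card_Un_disjoint) (auto simp: card_image inj_on_def)
  finally have "card (\<Union> (?e ` {..<k})) = 2 * k" by simp
  moreover have "?e ` {..<k} \<subseteq> lift_edges r m \<sigma>" using a by (auto simp: lift_edges_def)
  moreover have "pairwise disjnt (?e ` {..<k})"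
  proof (rule pairwise_imageI)
    fix x y assume xy: "x \<in> {..<k}" "y \<in> {..<k}" "x \<noteq> y"
    then show "disjnt (?e x) (?e y)"
      using heads[of x y] cross[of x y] cross[of y x] tails[of x y] by (auto simp: disjnt_def)
  qed
  ultimately show thesis by (intro that[of "?e ` {..<k}"])
qed

definition inner_arcs :: "nat \<Rightarrow> nat \<Rightarrow> (arc \<Rightarrow> arc) \<Rightarrow> nat set \<Rightarrow> arc set" where
  "inner_arcs r m \<sigma> W = {q\<in>arcs r m. tail q \<in> W \<and> head (\<sigma> q) \<in> W}"

text \<open>A permutation that puts \<open>2 * w\<close> arcs inside \<open>W\<close> extends one of the prescriptions of \<open>2 * w\<close> values
  inside \<open>W\<close>. An arc together with its prescribed end is determined by the two end points in \<open>W\<close>, so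
  there are at most \<open>w * w\<close> candidates for a single value.\<close>

lemma card_dense_perms:
  assumes W: "finite W" "card W = w" and w: "4 * w \<le> m"
  shows "card {\<sigma>\<in>fiber_perms (arcs r m). 2 * w \<le> card (inner_arcs r m \<sigma> W)} * m ^ (2 * w) \<le>
    ((w * w choose (2 * w)) * 2 ^ (2 * w)) * card (fiber_perms (arcs r m))"
proof -
  let ?X = "arcs r m"
  define pot where "pot = {z\<in>?X \<times> ?X. fst (fst z) = fst (snd z) \<and> tail (fst z) \<in> W \<and> head (snd z) \<in> W}"
  have finpot: "finite pot" using finite_arcs by (simp add: pot_def)
  have "inj_on (\<lambda>z. (tail (fst z), head (snd z))) pot"
    by (auto simp: inj_on_def pot_def tail_def head_def prod_eq_iff)
  moreover have "(\<lambda>z. (tail (fst z), head (snd z))) ` pot \<subseteq> W \<times> W" by (auto simp: pot_def)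
  ultimately have cpot: "card pot \<le> w * w"
    using W card_inj_on_le[of _ pot "W \<times> W"] by (simp add: card_cartesian_product)
  define \<F> where "\<F> = {F. F \<subseteq> pot \<and> card F = 2 * w}"
  have fin\<F>: "finite \<F>" using finpot by (simp add: \<F>_def)
  have c\<F>: "card \<F> \<le> w * w choose (2 * w)"
    unfolding \<F>_def n_subsets[OF finpot] using cpot by (rule binomial_right_mono)
  have "{\<sigma>\<in>fiber_perms ?X. 2 * w \<le> card (inner_arcs r m \<sigma> W)} \<subseteq> (\<Union>F\<in>\<F>. extending ?X F)"
  proof
    fix \<sigma> assume "\<sigma> \<in> {\<sigma>\<in>fiber_perms ?X. 2 * w \<le> card (inner_arcs r m \<sigma> W)}"
    then have s: "\<sigma> \<in> fiber_perms ?X" and big: "2 * w \<le> card (inner_arcs r m \<sigma> W)" by auto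
    obtain Q where Q: "Q \<subseteq> inner_arcs r m \<sigma> W" "card Q = 2 * w"
      using obtain_subset_with_card_n[OF big] by blast
    let ?F = "(\<lambda>q. (q, \<sigma> q)) ` Q"
    have "?F \<subseteq> pot"
      using Q(1) fiber_permsD[OF s] by (auto simp: pot_def inner_arcs_def)
    moreover have "card ?F = 2 * w" using Q(2) by (simp add: card_image inj_on_def)
    moreover have "\<sigma> \<in> extending ?X ?F" using s by (auto simp: extending_def)
    ultimately show "\<sigma> \<in> (\<Union>F\<in>\<F>. extending ?X F)" unfolding \<F>_def by blast
  qed
  then have "card {\<sigma>\<in>fiber_perms ?X. 2 * w \<le> card (inner_arcs r m \<sigma> W)} \<le> card (\<Union>F\<in>\<F>. extending ?X F)"
    using fin\<F> finite_fiber_perms[OF finite_arcs] by (intro card_mono) (auto simp: extending_def)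
  also have "\<dots> \<le> (\<Sum>F\<in>\<F>. card (extending ?X F))" by (rule card_UN_le[OF fin\<F>])
  finally have "card {\<sigma>\<in>fiber_perms ?X. 2 * w \<le> card (inner_arcs r m \<sigma> W)} * m ^ (2 * w)
      \<le> (\<Sum>F\<in>\<F>. card (extending ?X F) * m ^ (2 * w))"
    by (simp add: sum_distrib_right[symmetric])
  also have "\<dots> \<le> (\<Sum>F\<in>\<F>. 2 ^ (2 * w) * card (fiber_perms ?X))"
  proof (rule sum_mono)
    fix F assume F: "F \<in> \<F>"
    then have "finite F" "fst ` F \<subseteq> ?X" "card F = 2 * w"
      using finpot finite_subset by (auto simp: \<F>_def pot_def)
    then show "card (extending ?X F) * m ^ (2 * w) \<le> 2 ^ (2 * w) * card (fiber_perms ?X)"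
      using card_extending[of F ?X m] finite_arcs arcs_fiber w by simp
  qed
  also have "\<dots> \<le> ((w * w choose (2 * w)) * 2 ^ (2 * w)) * card (fiber_perms ?X)"
    using c\<F> by simp
  finally show ?thesis .
qed

lemma exists_sparse_lift:
  "\<exists>\<sigma>\<in>fiber_perms (arcs r m). \<forall>W\<subseteq>lift_verts r m. 81 * r * card W \<le> m \<longrightarrow>
     card {e\<in>lift_edges r m \<sigma>. e \<subseteq> W} \<le> 2 * card W"
proof -
  let ?X = "arcs r m"
  let ?N = "card (fiber_perms ?X)"
  define k where "k = m div (81 * r)"
  define dense where "dense W = {\<sigma>\<in>fiber_perms ?X. 2 * card W \<le> card (inner_arcs r m \<sigma> W)}" for W
  define \<W> where "\<W> w = {W. W \<subseteq> lift_verts r m \<and> card W = w}" for w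
  have fin: "finite (fiber_perms ?X)" by (rule finite_fiber_perms[OF finite_arcs])
  have "id \<in> fiber_perms ?X" by (simp add: fiber_perms_def permutes_id)
  then have N: "0 < ?N" using fin card_gt_0_iff by blast
  have fin\<W>: "finite (\<W> w)" for w using lift_verts_finite by (simp add: \<W>_def)
  have bound: "3 ^ w * (\<Sum>W\<in>\<W> w. card (dense W)) \<le> ?N" if w: "w \<in> {1..k}" for w
  proof -
    have "81 * r * w \<le> 81 * r * k" using w by simp
    also have "\<dots> \<le> m" unfolding k_def by (rule times_div_less_eq_dividend)
    finally have wm: "81 * r * w \<le> m" .
    have "0 < k" using w by simp
    then have r: "0 < r" by (cases r) (auto simp: k_def)
    have m: "0 < m" using \<open>0 < k\<close> by (cases m) (auto simp: k_def)
    have "4 * w \<le> 81 * r * w" using r by simp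
    then have w4: "4 * w \<le> m" using wm by linarith
    let ?b = "(w * w choose (2 * w)) * 2 ^ (2 * w)"
    have "(3 ^ w * (\<Sum>W\<in>\<W> w. card (dense W))) * m ^ (2 * w) =
        3 ^ w * (\<Sum>W\<in>\<W> w. card (dense W) * m ^ (2 * w))" by (simp add: sum_distrib_right)
    also have "\<dots> \<le> 3 ^ w * (\<Sum>W\<in>\<W> w. ?b * ?N)"
    proof (intro mult_le_mono2 sum_mono)
      fix W assume "W \<in> \<W> w"
      then have "finite W" "card W = w" using lift_verts_finite finite_subset by (auto simp: \<W>_def)
      then show "card (dense W) * m ^ (2 * w) \<le> ?b * ?N"
        using card_dense_perms[OF _ _ w4] by (simp add: dense_def)
    qed
    also have "\<dots> = (3 ^ w * ((r * m choose w) * ?b)) * ?N"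
      by (simp add: \<W>_def n_subsets[OF lift_verts_finite] card_lift_verts)
    also have "\<dots> \<le> m ^ (2 * w) * ?N"
      using union_bound_arith[OF _ wm] w by (intro mult_le_mono1) auto
    finally have "(3 ^ w * (\<Sum>W\<in>\<W> w. card (dense W))) * m ^ (2 * w) \<le> ?N * m ^ (2 * w)"
      by (simp only: mult.commute)
    then show ?thesis using m by simp
  qed
  have "card (\<Union>w\<in>{1..k}. \<Union>W\<in>\<W> w. dense W) \<le> (\<Sum>w=1..k. \<Sum>W\<in>\<W> w. card (dense W))"
    by (intro order_trans[OF card_UN_le] sum_mono card_UN_le fin\<W>) auto
  also have "\<dots> < ?N" using bound N by (rule sum_geometric_third)
  finally have "\<not> fiber_perms ?X \<subseteq> (\<Union>w\<in>{1..k}. \<Union>W\<in>\<W> w. dense W)"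
    using card_mono[of "\<Union>w\<in>{1..k}. \<Union>W\<in>\<W> w. dense W" "fiber_perms ?X"] fin\<W> fin
    by (fastforce simp: dense_def)
  then obtain \<sigma> where s: "\<sigma> \<in> fiber_perms ?X" "\<sigma> \<notin> (\<Union>w\<in>{1..k}. \<Union>W\<in>\<W> w. dense W)" by blast
  have "card {e\<in>lift_edges r m \<sigma>. e \<subseteq> W} \<le> 2 * card W"
    if W: "W \<subseteq> lift_verts r m" "81 * r * card W \<le> m" for W
  proof (cases "W = {}")
    case True
    then show ?thesis by (auto simp: lift_edges_def)
  next
    case False
    have finW: "finite W" using W(1) lift_verts_finite finite_subset by blast
    then have pos: "1 \<le> card W" using False by (simp add: Suc_le_eq card_gt_0_iff)
    have "0 < r" using W(1) False by (cases r) (auto simp: lift_verts_def)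
    then have "card W \<le> k" using W(2) unfolding k_def by (simp add: less_eq_div_iff_mult_less_eq mult.commute)
    then have "\<sigma> \<notin> dense W" using s(2) pos W(1) by (auto simp: \<W>_def)
    then have "card (inner_arcs r m \<sigma> W) \<le> 2 * card W" using s(1) by (simp add: dense_def)
    moreover have "{e\<in>lift_edges r m \<sigma>. e \<subseteq> W} = (\<lambda>q. {tail q, head (\<sigma> q)}) ` inner_arcs r m \<sigma> W"
      by (auto simp: lift_edges_def inner_arcs_def)
    moreover have "finite (inner_arcs r m \<sigma> W)" using finite_arcs by (simp add: inner_arcs_def)
    ultimately show ?thesis
      using card_image_le[of "inner_arcs r m \<sigma> W" "\<lambda>q. {tail q, head (\<sigma> q)}"] by simp
  qed
  then show ?thesis using s(1) by blast
qed

section \<open>Sparse regular graphs of every large order\<close>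

lemma exists_equal_fibers:
  assumes "finite A" "finite B" "card A = d * card B"
  shows "\<exists>f. f ` A \<subseteq> B \<and> (\<forall>b\<in>B. card {a\<in>A. f a = b} = d)"
proof -
  have "card A = card (B \<times> {..<d})" using assms by (simp add: card_cartesian_product)
  then obtain h where h: "bij_betw h A (B \<times> {..<d})"
    using assms finite_same_card_bij[of A "B \<times> {..<d}"] by auto
  note im = bij_betw_imp_surj_on[OF h]
  have "card {a\<in>A. fst (h a) = b} = d" if "b \<in> B" for b
  proof -
    have "h ` {a\<in>A. fst (h a) = b} = {b} \<times> {..<d}"
    proof (intro equalityI subsetI)
      fix z assume "z \<in> h ` {a\<in>A. fst (h a) = b}"
      then obtain a where "a \<in> A" "z = h a" "fst z = b" by blast
      moreover from this have "z \<in> B \<times> {..<d}" using im by blast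
      ultimately show "z \<in> {b} \<times> {..<d}" by (simp add: mem_Times_iff)
    next
      fix z assume z: "z \<in> {b} \<times> {..<d}"
      then have "z \<in> h ` A" unfolding im using that by auto
      then obtain a where "a \<in> A" "z = h a" by blast
      then show "z \<in> h ` {a\<in>A. fst (h a) = b}" using z by (intro image_eqI[of _ _ a]) auto
    qed
    moreover have "inj_on h {a\<in>A. fst (h a) = b}"
      using bij_betw_imp_inj_on[OF h] by (rule inj_on_subset) auto
    ultimately have "card {a\<in>A. fst (h a) = b} = card ({b} \<times> {..<d})"
      using card_image[of h "{a\<in>A. fst (h a) = b}"] by (simp only:)
    then show ?thesis by (simp add: card_cartesian_product)
  qed
  moreover have "(\<lambda>a. fst (h a)) ` A \<subseteq> B"
  proof (rule image_subsetI)
    fix a assume "a \<in> A"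
    then have "h a \<in> B \<times> {..<d}" using im by blast
    then show "fst (h a) \<in> B" by (simp add: mem_Times_iff)
  qed
  ultimately show ?thesis by (intro exI[of _ "\<lambda>a. fst (h a)"]) auto
qed

text \<open>Each end point \<open>u\<close> of the matching \<open>Mt\<close> trades its partner for the new vertex \<open>f u\<close>, so old degrees do
  not change, and new vertices have the degrees that \<open>f\<close> gives them. The edges added inside \<open>W\<close> are at
  most one per vertex of \<open>W\<close>.\<close>

lemma insert_vertices:
  assumes G: "simple_graph V E" and reg: "regular_graph V E d"
    and Mt: "Mt \<subseteq> E" "pairwise disjnt Mt"
    and V': "finite V'" "V \<inter> V' = {}"
    and f: "f ` \<Union>Mt \<subseteq> V'" "\<forall>v\<in>V'. card {u\<in>\<Union>Mt. f u = v} = d"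
  defines "E' \<equiv> (E - Mt) \<union> (\<lambda>u. {f u, u}) ` \<Union>Mt"
  shows "simple_graph (V \<union> V') E'" (is ?simple)
    and "regular_graph (V \<union> V') E' d" (is ?regular)
    and "W \<subseteq> V \<union> V' \<Longrightarrow> card {e\<in>E'. e \<subseteq> W} \<le> card {e\<in>E. e \<subseteq> W \<inter> V} + card W"
proof -
  note finV = simple_graph_finite(1)[OF G] and finE = simple_graph_finite(2)[OF G]
  have EV: "e \<subseteq> V" "card e = 2" if "e \<in> E" for e using G that by (auto simp: simple_graph_def)
  have UV: "\<Union>Mt \<subseteq> V" using EV Mt(1) by blast
  have fV: "f u \<in> V'" "f u \<notin> V" "u \<in> V" "u \<notin> V'" if "u \<in> \<Union>Mt" for u
    using f(1) V'(2) UV that by blast+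
  show ?simple
    unfolding simple_graph_def
  proof (intro conjI ballI)
    fix e assume "e \<in> E'"
    then consider "e \<in> E" | u where "u \<in> \<Union>Mt" "e = {f u, u}" by (auto simp: E'_def)
    then have "e \<subseteq> V \<union> V' \<and> card e = 2"
    proof cases
      case 2
      then have "f u \<noteq> u" using fV[of u] by metis
      then show ?thesis using fV[OF 2(1)] 2(2) by auto
    qed (use EV in auto)
    then show "e \<subseteq> V \<union> V'" "card e = 2" by auto
  qed (use finV V' in auto)
  show ?regular
    unfolding regular_graph_def
  proof
    fix u assume u: "u \<in> V \<union> V'"
    consider "u \<in> \<Union>Mt" | "u \<in> V" "u \<notin> \<Union>Mt" | "u \<in> V'" using u by blast
    then show "card (nbrs (V \<union> V') E' u) = d"
    proof cases
      case 1
      then obtain e where e: "e \<in> Mt" "u \<in> e" by blast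
      then obtain b where b: "e = {u, b}" "u \<noteq> b" "u \<in> V" "b \<in> V"
        using simple_graph_edge[OF G] Mt(1) by blast
      have mate: "{u, v} \<in> Mt \<longleftrightarrow> v = b" for v
      proof
        assume "{u, v} \<in> Mt"
        then have "{u, v} = {u, b}" using pairwiseD[OF Mt(2) _ e(1), of "{u, v}"] b by (auto simp: disjnt_def)
        then show "v = b" by (auto simp: doubleton_eq_iff)
      qed (use e b in auto)
      have "nbrs (V \<union> V') E' u = insert (f u) (nbrs V E u - {b})"
      proof (intro equalityI subsetI)
        fix v assume "v \<in> nbrs (V \<union> V') E' u"
        then have v: "v \<in> V \<union> V'" "{u, v} \<in> E'" by (auto simp: nbrs_def)
        from v(2) consider "{u, v} \<in> E" "{u, v} \<notin> Mt" | w where "w \<in> \<Union>Mt" "{u, v} = {f w, w}"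
          by (auto simp: E'_def)
        then show "v \<in> insert (f u) (nbrs V E u - {b})"
        proof cases
          case 1
          then show ?thesis using mate EV[OF 1(1)] by (auto simp: nbrs_def)
        next
          case 2
          then have "u \<noteq> f w" using fV[OF 2(1)] b(3) by metis
          then show ?thesis using 2(2) by (auto simp: doubleton_eq_iff)
        qed
      next
        fix v assume v: "v \<in> insert (f u) (nbrs V E u - {b})"
        show "v \<in> nbrs (V \<union> V') E' u"
        proof (cases "v = f u")
          case True
          then have "{u, v} = {f u, u}" by auto
          then show ?thesis using 1 fV[OF 1] True unfolding nbrs_def E'_def by blast
        next
          case False
          then show ?thesis using v mate by (auto simp: nbrs_def E'_def)
        qed
      qed
      moreover have "b \<in> nbrs V E u" using e b Mt(1) by (auto simp: nbrs_def)
      moreover have "f u \<notin> nbrs V E u" using fV[OF 1] by (simp add: nbrs_def)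
      moreover have "finite (nbrs V E u)" using finV by (simp add: nbrs_def)
      moreover have "card (nbrs V E u) = d" using reg b(3) by (simp add: regular_graph_def)
      ultimately show ?thesis using card_Suc_Diff1[of "nbrs V E u" b] by simp
    next
      case 2
      have "{u, v} \<in> E' \<longleftrightarrow> {u, v} \<in> E" for v
      proof
        assume "{u, v} \<in> E'"
        moreover have "{u, v} \<noteq> {f w, w}" if "w \<in> \<Union>Mt" for w
          using fV[OF that] 2 that by (auto simp: doubleton_eq_iff)
        ultimately show "{u, v} \<in> E" by (auto simp: E'_def)
      next
        assume "{u, v} \<in> E"
        then show "{u, v} \<in> E'" using 2(2) by (auto simp: E'_def)
      qed
      then have "nbrs (V \<union> V') E' u = nbrs V E u" using EV by (fastforce simp: nbrs_def)
      then show ?thesis using reg 2(1) by (simp add: regular_graph_def)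
    next
      case 3
      have "nbrs (V \<union> V') E' u = {w\<in>\<Union>Mt. f w = u}"
      proof (intro equalityI subsetI)
        fix v assume "v \<in> nbrs (V \<union> V') E' u"
        then have v: "{u, v} \<in> E'" by (auto simp: nbrs_def)
        have "{u, v} \<notin> E" using EV 3 V'(2) by blast
        then obtain w where w: "w \<in> \<Union>Mt" "{u, v} = {f w, w}" using v by (auto simp: E'_def)
        have "u \<noteq> w" using fV[OF w(1)] 3 by metis
        then have "u = f w" "v = w" using w(2) by (auto simp: doubleton_eq_iff)
        then show "v \<in> {w\<in>\<Union>Mt. f w = u}" using w(1) by simp
      next
        fix v assume "v \<in> {w\<in>\<Union>Mt. f w = u}"
        then show "v \<in> nbrs (V \<union> V') E' u" using UV unfolding nbrs_def E'_def by blast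
      qed
      then show ?thesis using bspec[OF f(2) 3] by simp
    qed
  qed
  assume W: "W \<subseteq> V \<union> V'"
  then have finW: "finite W" using finV V'(1) finite_subset by blast
  \<comment> \<open>A new edge inside \<open>W\<close> is determined by its old end point, which lies in \<open>W\<close>.\<close>
  have "{e\<in>E'. e \<subseteq> W} \<subseteq> {e\<in>E. e \<subseteq> W \<inter> V} \<union> (\<lambda>u. {f u, u}) ` W"
    using EV by (auto simp: E'_def)
  then have "card {e\<in>E'. e \<subseteq> W} \<le> card ({e\<in>E. e \<subseteq> W \<inter> V} \<union> (\<lambda>u. {f u, u}) ` W)"
    using finE finW by (intro card_mono) auto
  also have "\<dots> \<le> card {e\<in>E. e \<subseteq> W \<inter> V} + card ((\<lambda>u. {f u, u}) ` W)" by (rule card_Un_le)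
  also have "card ((\<lambda>u. {f u, u}) ` W) \<le> card W" using finW by (rule card_image_le)
  finally show "card {e\<in>E'. e \<subseteq> W} \<le> card {e\<in>E. e \<subseteq> W \<inter> V} + card W" by simp
qed

text \<open>With \<open>r = 2 * k + 1\<close> fibers of size \<open>m = n div r\<close>, the \<open>s = n mod r\<close> missing vertices need a matching of
  \<open>k * s\<close> edges, whence the lower bound on \<open>n\<close>.\<close>

lemma exists_sparse_regular_graph:
  assumes k: "1 \<le> k" and n: "(2 * k + 1) * (2 * k * k) < n"
  defines "r \<equiv> 2 * k + 1"
  shows "\<exists>(V::nat set) E. card V = n \<and> sparse_regular_graph V E (2 * k) 3 (n div r div (81 * r))"
proof -
  define m s where "m = n div r" and "s = n mod r"
  have nms: "r * m + s = n" by (simp add: m_def s_def)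
  have s: "s \<le> 2 * k" using mod_less_divisor[of r n] by (simp add: r_def s_def)
  have "2 * k * k \<le> m"
    using n unfolding m_def by (simp add: less_eq_div_iff_mult_less_eq r_def mult.commute)
  moreover have "k * s \<le> k * (2 * k)" by (rule mult_le_mono2[OF s])
  moreover have "k * (2 * k) = 2 * k * k" by simp
  ultimately have ks: "k * s \<le> m" by linarith
  have r: "2 \<le> r" using k by (simp add: r_def)
  obtain \<sigma> where \<sigma>: "\<sigma> \<in> fiber_perms (arcs r m)"
    and sparse: "\<And>W. W \<subseteq> lift_verts r m \<Longrightarrow> 81 * r * card W \<le> m \<Longrightarrow>
     card {e\<in>lift_edges r m \<sigma>. e \<subseteq> W} \<le> 2 * card W"
    using exists_sparse_lift[of r m] by blast
  let ?V = "lift_verts r m" and ?E = "lift_edges r m \<sigma>"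
  note G = lift_simple[OF \<sigma>]
  have reg: "regular_graph ?V ?E (2 * k)" using lift_regular[OF \<sigma>] by (simp add: r_def)
  obtain Mt where Mt: "Mt \<subseteq> ?E" "card (\<Union>Mt) = 2 * (k * s)" "pairwise disjnt Mt"
    using lift_matching[OF \<sigma> r ks] by blast
  have "infinite (- ?V)" using lift_verts_finite infinite_UNIV_nat finite_compl by blast
  then obtain V' where V': "finite V'" "card V' = s" "V' \<subseteq> - ?V"
    using infinite_arbitrarily_large by blast
  have "finite (\<Union>Mt)"
    by (rule finite_subset[OF _ lift_verts_finite[of r m]]) (use Mt(1) G in \<open>auto simp: simple_graph_def\<close>)
  then obtain f where f: "f ` \<Union>Mt \<subseteq> V'" "\<forall>v\<in>V'. card {u\<in>\<Union>Mt. f u = v} = 2 * k"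
    using exists_equal_fibers[of "\<Union>Mt" V' "2 * k"] V' Mt(2) by auto
  define E' where "E' = (?E - Mt) \<union> (\<lambda>u. {f u, u}) ` \<Union>Mt"
  have disj: "?V \<inter> V' = {}" using V'(3) by auto
  note ins = insert_vertices[OF G reg Mt(1,3) V'(1) disj f, folded E'_def]
  have "card (?V \<union> V') = n"
    using V' lift_verts_finite disj nms by (simp add: card_Un_disjoint card_lift_verts)
  moreover have "sparse_regular_graph (?V \<union> V') E' (2 * k) 3 (m div (81 * r))"
  proof
    show "simple_graph (?V \<union> V') E'" "regular_graph (?V \<union> V') E' (2 * k)" using ins(1,2) by auto
    fix W assume W: "W \<subseteq> ?V \<union> V'" "card W \<le> m div (81 * r)"
    have "finite W" using W(1) lift_verts_finite V'(1) finite_subset by blast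
    then have le: "card (W \<inter> ?V) \<le> card W" by (intro card_mono) auto
    have "81 * r * card (W \<inter> ?V) \<le> 81 * r * (m div (81 * r))"
      using le W(2) by (intro mult_le_mono2) linarith
    also have "\<dots> \<le> m" by (rule times_div_less_eq_dividend)
    finally have "card {e\<in>?E. e \<subseteq> W \<inter> ?V} \<le> 2 * card (W \<inter> ?V)" by (intro sparse) auto
    then show "card {e\<in>E'. e \<subseteq> W} \<le> 3 * card W" using ins(3)[OF W(1)] le by linarith
  qed
  ultimately show ?thesis unfolding m_def by blast
qed


section \<open>Linear lattice rank\<close>

lemma less_mult_Suc_div: "0 < b \<Longrightarrow> a < b * Suc (a div b)" for a b :: nat
  using dividend_less_times_div by auto

theorem mainTheorem3:
  fixes t :: nat
  assumes "t \<ge> 1"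
  shows "\<exists>(n0::nat) (\<alpha>::real). n0 > 0 \<and> \<alpha> > 0 \<and>
    (\<forall>n::nat. odd n \<and> n > n0 \<longrightarrow>
      (\<exists>(V::nat set) (E::nat set set).
         simple_graph V E \<and> regular_graph V E (20 * t) \<and>
         card V = n \<and> card E = 10 * n * t \<and>
         ereal (\<alpha> * real n) \<le> ereal_of_enat (lattice_rank E t (tseitin_polytope V E))))"
proof -
  define r where "r = 20 * t + 1"
  define n0 where "n0 = r * (200 * t * t)"
  define C where "C = r * (81 * r * t)"
  have C: "0 < C" using assms by (simp add: C_def r_def)
  have "\<exists>(V::nat set) (E::nat set set).
         simple_graph V E \<and> regular_graph V E (20 * t) \<and>
         card V = n \<and> card E = 10 * n * t \<and>
         ereal (1 / real C * real n) \<le> ereal_of_enat (lattice_rank E t (tseitin_polytope V E))"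
    if n: "odd n" "n > n0" for n
  proof -
    define M where "M = n div r div (81 * r)"
    define K where "K = M div t"
    have "\<exists>(V::nat set) E. card V = n \<and> sparse_regular_graph V E (20 * t) 3 M"
      using exists_sparse_regular_graph[of "10 * t" n] assms n(2)
      by (simp add: M_def r_def n0_def)
    then obtain V :: "nat set" and E where V: "card V = n" and G: "sparse_regular_graph V E (20 * t) 3 M"
      by blast
    interpret sparse_regular_graph V E "20 * t" 3 M by (rule G)
    have "2 * card E = (\<Sum>u\<in>V. card {e\<in>E. u \<in> e})"
      using sum_incident_inside[OF finE finV] edge_card edge_sub by simp
    also have "\<dots> = n * (20 * t)" using card_incident[OF graph regular] V by simp
    finally have cardE: "card E = 10 * n * t" by simp
    \<comment> \<open>Three nested roundings down, of \<open>n / r\<close>, of \<open>m / (81 * r)\<close> and of \<open>M / t\<close>, cost a constant factor only.\<close>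
    have "n < r * Suc (n div r)" by (rule less_mult_Suc_div) (simp add: r_def)
    also have "\<dots> \<le> r * (81 * r * Suc M)"
      unfolding M_def by (intro mult_le_mono2 Suc_leI less_mult_Suc_div) (simp add: r_def)
    also have "\<dots> \<le> r * (81 * r * (t * Suc K))"
      unfolding K_def using assms by (intro mult_le_mono2 Suc_leI less_mult_Suc_div) simp
    also have "\<dots> = C * Suc K" by (simp only: C_def mult.assoc)
    finally have "n \<le> C * Suc K" by simp
    then have "real n \<le> real (C * Suc K)" by (simp only: of_nat_le_iff)
    then have "1 / real C * real n \<le> real (Suc K)" using C by (simp add: field_simps)
    then have "ereal (1 / real C * real n) \<le> ereal_of_enat (enat (Suc K))" by simp
    also have "\<dots> \<le> ereal_of_enat (lattice_rank E t (tseitin_polytope V E))"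
      unfolding ereal_of_enat_le_iff
      by (rule lattice_rank_ge) (use assms V n in \<open>auto simp: K_def\<close>)
    finally show ?thesis using graph regular V cardE by blast
  qed
  moreover have "0 < n0" using assms by (simp add: n0_def r_def)
  ultimately show ?thesis using C by (intro exI[of _ n0] exI[of _ "1 / real C"]) simp
qed

end
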